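(* Let $G$ be a compact connected Abelian topological group equipped with Haar measure $\mu$ satisfying $\mu(G)=1$. For any measurable functions $f,g,h:G\to[0,1]$, $$\langle f*g,h\rangle_G\le\langle\mathbf 1_{A^\star}*\mathbf 1_{B^\star},\mathbf 1_{C^\star}\rangle_{\mathbb T},$$ where $A^\star,B^\star,C^\star\subset\mathbb T$ are intervals centered at $0$ satisfying $$(m(A^\star),m(B^\star),m(C^\star))=\Big(\int_G f\,d\mu,\ \int_G g\,d\mu,\ \int_G h\,d\mu\Big).$$
   Context: Haar measure is complete; measurable means $\mu$-measurable. $\mathbb T=\mathbb R/\mathbb Z$ with Lebesgue measure $m$, $m(\mathbb T)=1$. Convolution: $f*g(x)=\int f(x-y)g(y)\,dy$ with respect to $\mu$ on $G$, or $m$ on $\mathbb T$. $\langle\varphi,\psi\rangle_G=\int_G\varphi\psi\,d\mu$ and $\langle\varphi,\psi\rangle_{\mathbb T}=\int_{\mathbb T}\varphi\psi\,dm$ for real-valued functions. *)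

theory Defs
  imports "HOL-Analysis.Analysis"
begin

section \<open>Haar measure\<close>

text \<open>
  Radon measures on the Borel sets: finite on compact sets, outer regular on Borel sets and
  inner regular on open sets.  The regularity conditions are not automatic, because the underlying
  group need not be metrizable.
\<close>

definition radon_borel_measure :: "'a::topological_space measure \<Rightarrow> bool" where
  "radon_borel_measure \<nu> \<longleftrightarrow>
     sets \<nu> = sets borel \<and>
     (\<forall>K. compact K \<longrightarrow> emeasure \<nu> K < \<infinity>) \<and>
     (\<forall>E\<in>sets borel. emeasure \<nu> E = (INF U\<in>{U. open U \<and> E \<subseteq> U}. emeasure \<nu> U)) \<and>
     (\<forall>U. open U \<longrightarrow> emeasure \<nu> U = (SUP K\<in>{K. compact K \<and> K \<subseteq> U}. emeasure \<nu> K))"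

text \<open>
  Haar measures are taken to be complete: \<open>\<mu>\<close> is the completion of a nonzero translation
  invariant Radon measure \<open>\<nu>\<close> on the Borel sets.
\<close>

definition haar_measure :: "'a::topological_ab_group_add measure \<Rightarrow> bool" where
  "haar_measure \<mu> \<longleftrightarrow>
     (\<exists>\<nu>. radon_borel_measure \<nu> \<and> emeasure \<nu> UNIV \<noteq> 0 \<and>
          (\<forall>a. \<forall>E\<in>sets borel. emeasure \<nu> ((+) a ` E) = emeasure \<nu> E) \<and>
          \<mu> = completion \<nu>)"

section \<open>Convolution and pairing\<close>

definition conv :: "'a::ab_group_add measure \<Rightarrow> ('a \<Rightarrow> real) \<Rightarrow> ('a \<Rightarrow> real) \<Rightarrow> 'a \<Rightarrow> real" where
  "conv M f g x = (\<integral>y. f (x - y) * g y \<partial>M)"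

definition pairing :: "'a measure \<Rightarrow> ('a \<Rightarrow> real) \<Rightarrow> ('a \<Rightarrow> real) \<Rightarrow> real" where
  "pairing M \<phi> \<psi> = (\<integral>x. \<phi> x * \<psi> x \<partial>M)"

section \<open>The circle group\<close>

definition int_cong :: "real \<Rightarrow> real \<Rightarrow> bool" where
  "int_cong x y \<longleftrightarrow> x - y \<in> \<int>"

lemma equivp_int_cong: "equivp int_cong"
proof (rule equivpI)
  show "reflp int_cong" by (simp add: reflp_def int_cong_def)
  show "symp int_cong" unfolding symp_def int_cong_def by (metis Ints_minus minus_diff_eq)
  show "transp int_cong" unfolding transp_def int_cong_def
  proof (intro allI impI)
    fix x y z :: real assume "x - y \<in> \<int>" "y - z \<in> \<int>"
    then have "(x - y) + (y - z) \<in> \<int>" by (rule Ints_add)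
    then show "x - z \<in> \<int>" by simp
  qed
qed

quotient_type circle = real / int_cong
  by (rule equivp_int_cong)

instantiation circle :: ab_group_add
begin

lift_definition zero_circle :: circle is "0 :: real" .

lift_definition plus_circle :: "circle \<Rightarrow> circle \<Rightarrow> circle" is "(+)"
proof -
  fix x x' y y' :: real assume "int_cong x x'" "int_cong y y'"
  then have "(x - x') + (y - y') \<in> \<int>" unfolding int_cong_def by (rule Ints_add)
  then show "int_cong (x + y) (x' + y')" by (simp add: int_cong_def algebra_simps)
qed

lift_definition uminus_circle :: "circle \<Rightarrow> circle" is uminus
proof -
  fix x x' :: real assume "int_cong x x'"
  then have "- (x - x') \<in> \<int>" unfolding int_cong_def by (rule Ints_minus)
  then show "int_cong (- x) (- x')" by (simp add: int_cong_def)
qed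

lift_definition minus_circle :: "circle \<Rightarrow> circle \<Rightarrow> circle" is "(-)"
proof -
  fix x x' y y' :: real assume "int_cong x x'" "int_cong y y'"
  then have "(x - x') - (y - y') \<in> \<int>" unfolding int_cong_def by (rule Ints_diff)
  then show "int_cong (x - y) (x' - y')" by (simp add: int_cong_def algebra_simps)
qed

instance
  by standard (transfer; simp add: int_cong_def)+

end

lift_definition to_circle :: "real \<Rightarrow> circle" is "\<lambda>x. x" .

lemma to_circle_eq_iff: "to_circle x = to_circle y \<longleftrightarrow> x - y \<in> \<int>"
  by transfer (simp add: int_cong_def)

lemma inj_on_to_circle: "inj_on to_circle {0..<1}"
proof (rule inj_onI)
  fix x y :: real assume xy: "x \<in> {0..<1}" "y \<in> {0..<1}" "to_circle x = to_circle y"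
  then obtain k where k: "x - y = of_int k"
    unfolding to_circle_eq_iff by (auto elim: Ints_cases)
  with xy have "-1 < k" "k < 1" by auto
  with k show "x = y" by auto
qed

lemma to_circle_image: "to_circle ` {0..<1} = UNIV"
proof -
  have "\<exists>x\<in>{0..<1}. t = to_circle x" for t
  proof -
    obtain x where x: "t = to_circle x" by transfer (auto simp: int_cong_def)
    have "to_circle (frac x) = t"
      unfolding x to_circle_eq_iff by (simp add: frac_def)
    then show ?thesis by (intro bexI[of _ "frac x"]) (auto simp: frac_lt_1)
  qed
  then show ?thesis by blast
qed

text \<open>Complete Lebesgue measure on the fundamental domain, transported to the circle.\<close>

definition circle_measure :: "circle measure" where
  "circle_measure = embed_measure (lebesgue_on {0..<1}) to_circle"

lemma space_circle_measure: "space circle_measure = UNIV"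
  by (simp add: circle_measure_def space_embed_measure to_circle_image)

lemma emeasure_circle_measure_UNIV: "emeasure circle_measure UNIV = 1"
proof -
  have "UNIV \<in> sets circle_measure"
    using sets.top[of circle_measure] by (simp add: space_circle_measure)
  then have "emeasure circle_measure UNIV = emeasure (lebesgue_on {0..<1}) {0..<1::real}"
    unfolding circle_measure_def
    by (subst emeasure_embed_measure') (auto simp: inj_on_to_circle)
  then show ?thesis by (simp add: emeasure_restrict_space)
qed

text \<open>
  Images of the open, closed and half-open intervals with endpoints \<open>-r\<close> and \<open>r\<close>; the
  empty set and \<open>{0}\<close> are included.
\<close>

definition centered_interval :: "circle set \<Rightarrow> bool" where
  "centered_interval A \<longleftrightarrow>
     (\<exists>r I. {-r<..<r} \<subseteq> I \<and> I \<subseteq> {-r..r} \<and> A = to_circle ` I)"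

end

(*
By density it suffices to treat continuous f, g, h with integrals a, b, c.  For such functions, the
heart of the matter is the Pollard-type inequality
  integral of min (f * g) t >= t (a + b - t)   whenever 0 <= t <= a, t <= b, a + b - t <= 1.
Let F(b) be the infimum of the left-hand side over all continuous g with values in [0, 1] and
integral b.  Pointwise bounds on f * g show that F(t) >= a t and F(1 + t - a) >= t, so the
inequality holds at the two ends of the range of b.  In between it follows because F is concave:
since min (., t) is concave, replacing g and a translate of g by a smaller and a larger function
with the same sum decreases the total truncated mass, and connectedness of G makes all small
differences of the integrals available (Ruzsa's argument).  Splitting f * g at height t bounds the
left-hand side of the theorem by a b - t (a + b - t) + t c.  On the circle the convolution of the two
indicators is an explicit trapezoid, and taking for t its smallest value over the third interval
the right-hand side is at least the same expression.
*)
theory Submission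
  imports Defs "HOL-Probability.Probability_Measure"
begin

section \<open>Integration of continuous functions on compact spaces\<close>

text \<open>The upper bound is a convex quadratic in \<open>t\<close> with vertex (a + b - c) / 2.
  The Pollard-type inequality is available only for \<open>t\<close> between max 0 (a + b - 1) and
  min a b, so \<open>t\<close> is the vertex moved to the nearest point of that range; this is the
  origin of the four cases at the end. The constraints may hold with equality, so measurable
  functions are approximated with their integrals kept exact.

  Concavity of F is reached only at limited scales: splitting a function of integral b gives steps
  of size at most b - b^2. The passage from the ends to the whole range is therefore a minimum
  principle, which uses that F is 1-Lipschitz.

  The group carries neither a metric nor a separation axiom. Regularity of the topology comes from
  the group operations, and with compactness it provides Urysohn functions. Translation invariance
  yields reflection invariance through double integrals of continuous kernels; outer regularity
  transfers it to Borel sets, and then to the completed measure.\<close>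

locale compact_prob_space = prob_space M for M :: "'a::topological_space measure" +
  assumes compact_space: "compact (UNIV :: 'a set)"
    and sets_borel: "sets M = sets borel"
begin

lemma space_UNIV: "space M = UNIV"
  using sets_eq_imp_space_eq[OF sets_borel] by simp

lemma continuous_measurable:
  fixes u :: "'a \<Rightarrow> real"
  assumes "continuous_on UNIV u"
  shows "u \<in> borel_measurable M"
  using borel_measurable_continuous_onI[OF assms] measurable_cong_sets[OF sets_borel refl] by auto

lemma continuous_bounded:
  fixes u :: "'a \<Rightarrow> real"
  assumes "continuous_on UNIV u"
  obtains B where "\<And>x. \<bar>u x\<bar> \<le> B"
  using compact_imp_bounded[OF compact_continuous_image[OF assms compact_space]]
  unfolding bounded_iff by auto

lemma continuous_integrable:
  fixes u :: "'a \<Rightarrow> real"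
  assumes "continuous_on UNIV u"
  shows "integrable M u"
proof -
  obtain B where "\<And>x. \<bar>u x\<bar> \<le> B" using continuous_bounded[OF assms] by blast
  then show ?thesis
    by (intro integrable_const_bound[where B = B]) (auto simp: continuous_measurable assms)
qed

lemma abs_integral_diff_le:
  fixes u v :: "'a \<Rightarrow> real"
  assumes u: "integrable M u" and v: "integrable M v" and uv: "\<And>x. \<bar>u x - v x\<bar> \<le> e"
  shows "\<bar>(\<integral>x. u x \<partial>M) - (\<integral>x. v x \<partial>M)\<bar> \<le> e"
proof -
  have *: "u x \<le> v x + e" "v x \<le> u x + e" for x using uv[of x] by linarith+
  have "(\<integral>x. u x \<partial>M) \<le> (\<integral>x. v x + e \<partial>M)"
    by (intro integral_mono) (auto simp: u v *)
  moreover have "(\<integral>x. v x \<partial>M) \<le> (\<integral>x. u x + e \<partial>M)"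
    by (intro integral_mono) (auto simp: u v *)
  ultimately show ?thesis using u v by (simp add: prob_space)
qed

text \<open>By compactness in \<open>y\<close>, the functions \<open>k x\<close> and
  \<open>k x0\<close> are uniformly close once \<open>x\<close> lies in a suitable neighbourhood of
  \<open>x0\<close>; the total mass is 1, so their integrals are equally close.\<close>

lemma continuous_parameter_integral:
  fixes k :: "'b::topological_space \<Rightarrow> 'a \<Rightarrow> real"
  assumes k: "continuous_on UNIV (\<lambda>(x, y). k x y)"
  shows "continuous_on UNIV (\<lambda>x. \<integral>y. k x y \<partial>M)"
proof -
  have ki: "integrable M (k x)" for x
  proof (rule continuous_integrable)
    have "continuous_on UNIV ((\<lambda>(x, y). k x y) \<circ> (\<lambda>y. (x, y)))"
      by (intro continuous_on_compose continuous_intros continuous_on_subset[OF k]) auto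
    then show "continuous_on UNIV (k x)" by (simp add: o_def)
  qed
  have "((\<lambda>x. \<integral>y. k x y \<partial>M) \<longlongrightarrow> (\<integral>y. k x0 y \<partial>M)) (at x0)" for x0
  proof (rule tendstoI)
    fix e :: real assume e: "e > 0"
    have k': "continuous_on (UNIV \<times> UNIV) (\<lambda>(x, y). k x y)" using k by simp
    from e have "e / 2 > 0" by simp
    from continuous_on_prod_compactE[OF k' compact_space UNIV_I this]
    obtain X where X: "x0 \<in> X" "open X"
      "\<forall>x\<in>X \<inter> UNIV. \<forall>t\<in>UNIV. dist (case (x, t) of (x, y) \<Rightarrow> k x y) (case (x0, t) of (x, y) \<Rightarrow> k x y) \<le> e/2"
      by metis
    have "dist (\<integral>y. k x y \<partial>M) (\<integral>y. k x0 y \<partial>M) < e" if "x \<in> X" for x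
    proof -
      have "\<bar>(\<integral>y. k x y \<partial>M) - (\<integral>y. k x0 y \<partial>M)\<bar> \<le> e / 2"
        using X(3) that by (intro abs_integral_diff_le ki) (auto simp: dist_real_def)
      then show ?thesis using e by (simp add: dist_real_def)
    qed
    then show "\<forall>\<^sub>F x in at x0. dist (\<integral>y. k x y \<partial>M) (\<integral>y. k x0 y \<partial>M) < e"
      unfolding eventually_at_topological using X by blast
  qed
  then show ?thesis by (simp add: continuous_on_def)
qed

text \<open>
  The product \<open>\<sigma>\<close>-algebra of two Borel \<open>\<sigma>\<close>-algebras may be too small for continuous functions
  on the product, so the library version of Fubini's theorem does not apply.
\<close>

lemma continuous_Fubini:
  fixes k :: "'a \<Rightarrow> 'a \<Rightarrow> real"
  assumes k: "continuous_on UNIV (\<lambda>(x, y). k x y)"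
  shows "(\<integral>x. (\<integral>y. k x y \<partial>M) \<partial>M) = (\<integral>y. (\<integral>x. k x y \<partial>M) \<partial>M)"
proof -
  have k1: "continuous_on UNIV (\<lambda>y. k x y)" for x
  proof -
    have "continuous_on UNIV ((\<lambda>(x, y). k x y) \<circ> (\<lambda>y. (x, y)))"
      by (intro continuous_on_compose continuous_intros continuous_on_subset[OF k]) auto
    then show ?thesis by (simp add: o_def)
  qed
  have k2: "continuous_on UNIV (\<lambda>x. k x y)" for y
  proof -
    have "continuous_on UNIV ((\<lambda>(x, y). k x y) \<circ> (\<lambda>x. (x, y)))"
      by (intro continuous_on_compose continuous_intros continuous_on_subset[OF k]) auto
    then show ?thesis by (simp add: o_def)
  qed
  have ks: "continuous_on UNIV (\<lambda>(y, x). k x y)"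
  proof -
    have "continuous_on UNIV ((\<lambda>(x, y). k x y) \<circ> prod.swap)"
      by (intro continuous_on_compose continuous_on_swap continuous_on_subset[OF k]) auto
    then show ?thesis by (simp add: o_def case_prod_beta)
  qed
  have I1: "integrable M (\<lambda>x. \<integral>y. k x y \<partial>M)"
    by (intro continuous_integrable continuous_parameter_integral k)
  have I2: "integrable M (\<lambda>y. \<integral>x. k x y \<partial>M)"
    by (intro continuous_integrable continuous_parameter_integral ks)
  \<comment> \<open>Both iterated integrals are compared with those of a kernel \<open>k'\<close>
    uniformly within \<open>e\<close> of \<open>k\<close>; each moves by at most \<open>e\<close>.
    Compactness supplies finitely many open sets on which \<open>k x y\<close> is nearly constant in
    \<open>y\<close>, uniformly in \<open>x\<close>.\<close>
  have "\<bar>(\<integral>x. (\<integral>y. k x y \<partial>M) \<partial>M) - (\<integral>y. (\<integral>x. k x y \<partial>M) \<partial>M)\<bar> \<le> e + e" if e: "e > 0" for e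
  proof -
    have "\<exists>V. y0 \<in> V \<and> open V \<and> (\<forall>y\<in>V. \<forall>x. \<bar>k x y - k x y0\<bar> \<le> e)" for y0
    proof -
      have k': "continuous_on (UNIV \<times> UNIV) (\<lambda>(y, x). k x y)" using ks by simp
      from continuous_on_prod_compactE[OF k' compact_space UNIV_I e]
      obtain X where X: "y0 \<in> X" "open X"
        "\<forall>y\<in>X \<inter> UNIV. \<forall>t\<in>UNIV. dist (case (y, t) of (y, x) \<Rightarrow> k x y) (case (y0, t) of (y, x) \<Rightarrow> k x y) \<le> e"
        by metis
      then show ?thesis by (intro exI[of _ X]) (auto simp: dist_real_def)
    qed
    then obtain V where V: "\<And>y. y \<in> V y" "\<And>y. open (V y)" "\<And>y0 y x. y \<in> V y0 \<Longrightarrow> \<bar>k x y - k x y0\<bar> \<le> e"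
      by metis
    have "\<forall>S\<in>range V. open S" "UNIV \<subseteq> \<Union> (range V)" using V by auto
    then obtain F where F: "F \<subseteq> range V" "finite F" "UNIV \<subseteq> \<Union> F"
      using compactE[OF compact_space] by (metis (no_types, lifting))
    then obtain Y where Y: "finite Y" "F = V ` Y" by (metis finite_subset_image)
    obtain ys where ys: "set ys = Y" using finite_list Y(1) by blast
    define n where "n = length ys"
    define E where "E = disjointed (\<lambda>i. if i < n then V (ys ! i) else {})"
    have Em: "E i \<in> sets M" for i
    proof -
      have "range E \<subseteq> sets M" unfolding E_def
        by (rule sets.range_disjointed_sets) (auto simp: sets_borel V)
      then show ?thesis by auto
    qed
    have Edis: "disjoint_family E" unfolding E_def by (rule disjoint_family_disjointed)
    have Ecov: "(\<Union>i. E i) = UNIV"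
    proof -
      have "\<exists>i<n. x \<in> V (ys ! i)" for x
        using F(3) unfolding Y(2) ys[symmetric] n_def by (auto simp: set_conv_nth)
      then show ?thesis unfolding E_def UN_disjointed_eq by fastforce
    qed
    have Esub: "E i \<subseteq> (if i < n then V (ys ! i) else {})" for i
      unfolding E_def by (rule disjointed_subset)
    \<comment> \<open>On each piece of a finite Borel partition \<open>y\<close> is frozen at a
      centre. The result is a finite sum of products, for which exchanging the integrals is
      linearity.\<close>
    define k' where "k' x y = (\<Sum>i<n. k x (ys ! i) * indicator (E i) y)" for x y
    have k'_eq: "k' x y = k x (ys ! i)" if "y \<in> E i" for x y i
    proof -
      have i: "i < n" using that Esub[of i] by (auto split: if_splits)
      have E_iff: "y \<in> E j \<longleftrightarrow> j = i" for j
        using Edis that unfolding disjoint_family_on_def by auto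
      have "k' x y = (\<Sum>j<n. if j = i then k x (ys ! j) else 0)"
        unfolding k'_def by (intro sum.cong) (auto simp: indicator_def E_iff)
      then show ?thesis using i by simp
    qed
    have close: "\<bar>k x y - k' x y\<bar> \<le> e" for x y
    proof -
      obtain i where i: "y \<in> E i" using Ecov by blast
      with Esub[of i] have "y \<in> V (ys ! i)" by (auto split: if_splits)
      then show ?thesis using k'_eq[OF i] V(3) by simp
    qed
    have intE: "integrable M (indicat_real (E i))" for i
      using Em by (intro integrable_real_indicator) (auto simp: less_top[symmetric])
    have k'y: "integrable M (\<lambda>y. k' x y)" for x unfolding k'_def
      using intE by (intro Bochner_Integration.integrable_sum integrable_mult_right) auto
    have k'x: "integrable M (\<lambda>x. k' x y)" for y unfolding k'_def
      by (intro Bochner_Integration.integrable_sum integrable_mult_left continuous_integrable k2)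
    have i1: "(\<integral>y. k' x y \<partial>M) = (\<Sum>i<n. k x (ys ! i) * measure M (E i))" for x
      unfolding k'_def using Em intE space_UNIV by (subst Bochner_Integration.integral_sum) auto
    have i2: "(\<integral>x. k' x y \<partial>M) = (\<Sum>i<n. (\<integral>x. k x (ys ! i) \<partial>M) * indicator (E i) y)" for y
      unfolding k'_def
      by (subst Bochner_Integration.integral_sum)
         (auto intro!: integrable_mult_left continuous_integrable k2)
    have J1: "integrable M (\<lambda>x. \<integral>y. k' x y \<partial>M)" unfolding i1
      by (intro Bochner_Integration.integrable_sum integrable_mult_left continuous_integrable k2)
    have J2: "integrable M (\<lambda>y. \<integral>x. k' x y \<partial>M)" unfolding i2
      using intE by (intro Bochner_Integration.integrable_sum integrable_mult_right) auto
    have eq: "(\<integral>x. (\<integral>y. k' x y \<partial>M) \<partial>M) = (\<integral>y. (\<integral>x. k' x y \<partial>M) \<partial>M)"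
      unfolding i1 i2 using Em intE space_UNIV
      by (subst (1 2) Bochner_Integration.integral_sum)
         (auto intro!: integrable_mult_left integrable_mult_right continuous_integrable k2)
    have "\<bar>(\<integral>x. (\<integral>y. k x y \<partial>M) \<partial>M) - (\<integral>x. (\<integral>y. k' x y \<partial>M) \<partial>M)\<bar> \<le> e"
      by (intro abs_integral_diff_le I1 J1 continuous_integrable k1 k'y close)
    moreover have "\<bar>(\<integral>y. (\<integral>x. k x y \<partial>M) \<partial>M) - (\<integral>y. (\<integral>x. k' x y \<partial>M) \<partial>M)\<bar> \<le> e"
      by (intro abs_integral_diff_le I2 J2 continuous_integrable k2 k'x close)
    ultimately show ?thesis using eq by linarith
  qed
  then have "\<bar>(\<integral>x. (\<integral>y. k x y \<partial>M) \<partial>M) - (\<integral>y. (\<integral>x. k x y \<partial>M) \<partial>M)\<bar> \<le> e" if "e > 0" for e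
    using that by (metis field_sum_of_halves half_gt_zero)
  then show ?thesis
    by (metis abs_le_zero_iff dense_ge diff_self eq_iff_diff_eq_0)
qed

end

section \<open>Convolution on compact groups\<close>

locale compact_haar = compact_prob_space M for M :: "'a::topological_ab_group_add measure" +
  assumes translate: "\<And>a E. E \<in> sets borel \<Longrightarrow> emeasure M ((+) a ` E) = emeasure M E"
begin

abbreviation unit_functions :: "('a \<Rightarrow> real) set" where
  "unit_functions \<equiv> {u. continuous_on UNIV u \<and> (\<forall>x. 0 \<le> u x \<and> u x \<le> 1)}"

lemma continuous_measurable_self:
  fixes \<phi> :: "'a \<Rightarrow> 'a"
  assumes "continuous_on UNIV \<phi>"
  shows "\<phi> \<in> measurable M M"
proof -
  have "\<phi> \<in> borel_measurable borel" by (rule borel_measurable_continuous_onI[OF assms])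
  then show ?thesis using measurable_cong_sets[OF sets_borel sets_borel] by blast
qed

lemma distr_translate: "distr M M (\<lambda>x. x + a) = M"
proof (rule measure_eqI)
  show "sets (distr M M (\<lambda>x. x + a)) = sets M" by simp
  fix E assume "E \<in> sets (distr M M (\<lambda>x. x + a))"
  then have E: "E \<in> sets M" by simp
  have m: "(\<lambda>x. x + a) \<in> measurable M M"
    by (intro continuous_measurable_self continuous_intros)
  have "(\<lambda>x. x + a) -` E = (+) (- a) ` E"
    by (auto simp: image_iff intro!: bexI[of _ "_ + a"])
  then show "emeasure (distr M M (\<lambda>x. x + a)) E = emeasure M E"
    using translate[of E "- a"] E by (simp add: emeasure_distr[OF m] space_UNIV sets_borel)
qed

lemma integral_translate:
  fixes u :: "'a \<Rightarrow> real"
  assumes "continuous_on UNIV u"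
  shows "(\<integral>x. u (x + a) \<partial>M) = (\<integral>x. u x \<partial>M)"
proof -
  have m: "(\<lambda>x. x + a) \<in> measurable M M"
    by (intro continuous_measurable_self continuous_intros)
  have "(\<integral>x. u x \<partial>M) = (\<integral>x. u x \<partial>distr M M (\<lambda>x. x + a))" by (simp add: distr_translate)
  also have "\<dots> = (\<integral>x. u (x + a) \<partial>M)"
    using m continuous_measurable[OF assms] by (rule integral_distr)
  finally show ?thesis by simp
qed

lemma continuous_on_convolution_kernel:
  fixes u v :: "'a \<Rightarrow> real"
  assumes "continuous_on UNIV u" "continuous_on UNIV v"
  shows "continuous_on UNIV (\<lambda>(x, y). u (x - y) * v y)"
  unfolding case_prod_beta
  by (intro continuous_intros continuous_on_compose2[OF assms(1)] continuous_on_compose2[OF assms(2)]) auto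

text \<open>
  Integrating \<open>u (x - y)\<close> first over \<open>y\<close> gives the integral of the reflection of \<open>u\<close>, while
  integrating first over \<open>x\<close> gives the integral of \<open>u\<close>.
\<close>

lemma integral_reflect_translate:
  fixes u :: "'a \<Rightarrow> real"
  assumes u: "continuous_on UNIV u"
  shows "(\<integral>y. u (x - y) \<partial>M) = (\<integral>y. u y \<partial>M)"
proof -
  have um: "continuous_on UNIV (\<lambda>y. u (- y))"
    by (intro continuous_on_compose2[OF u] continuous_intros) auto
  have J: "(\<integral>y. u (x - y) \<partial>M) = (\<integral>y. u (- y) \<partial>M)" for x
    using integral_translate[OF um, of "- x"] by simp
  have I: "(\<integral>x. u (x - y) \<partial>M) = (\<integral>x. u x \<partial>M)" for y
    using integral_translate[OF u, of "- y"] by simp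
  have "(\<integral>x. (\<integral>y. u (x - y) \<partial>M) \<partial>M) = (\<integral>y. (\<integral>x. u (x - y) \<partial>M) \<partial>M)"
    using continuous_Fubini[of "\<lambda>x y. u (x - y)"]
      continuous_on_convolution_kernel[OF u, of "\<lambda>_. 1"] by simp
  then show ?thesis unfolding I by (simp add: J prob_space)
qed

lemma continuous_conv:
  assumes "continuous_on UNIV f" "continuous_on UNIV g"
  shows "continuous_on UNIV (conv M f g)"
  using continuous_parameter_integral[OF continuous_on_convolution_kernel[OF assms]]
  by (simp add: conv_def[abs_def])

lemma integrable_convolution_kernel:
  fixes f g :: "'a \<Rightarrow> real"
  assumes "continuous_on UNIV f" "continuous_on UNIV g"
  shows "integrable M (\<lambda>y. f (x - y) * g y)"
proof -
  have "continuous_on UNIV (\<lambda>y. f (x - y))"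
    by (intro continuous_on_compose2[OF assms(1)] continuous_intros) auto
  then show ?thesis by (intro continuous_integrable continuous_on_mult assms(2))
qed

lemma integral_conv:
  assumes f: "continuous_on UNIV f" and g: "continuous_on UNIV g"
  shows "(\<integral>x. conv M f g x \<partial>M) = (\<integral>x. f x \<partial>M) * (\<integral>x. g x \<partial>M)"
proof -
  have "(\<integral>x. conv M f g x \<partial>M) = (\<integral>y. (\<integral>x. f (x - y) * g y \<partial>M) \<partial>M)"
    unfolding conv_def by (intro continuous_Fubini continuous_on_convolution_kernel f g)
  also have "\<dots> = (\<integral>y. (\<integral>x. f x \<partial>M) * g y \<partial>M)"
    using integral_translate[OF f, of "- y" for y] by simp
  finally show ?thesis by simp
qed

text \<open>The last bound integrates (1 - p) (1 - q) \<ge> 0 for values p, q in [0, 1]. At the two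
  ends of the range of the integral of \<open>g\<close>, the third and fourth bounds place the whole
  convolution below, respectively above, the truncation height.\<close>

lemma conv_bounds:
  assumes f: "f \<in> unit_functions" and g: "g \<in> unit_functions"
  shows "0 \<le> conv M f g x" "conv M f g x \<le> (\<integral>x. f x \<partial>M)" "conv M f g x \<le> (\<integral>x. g x \<partial>M)"
    "(\<integral>x. f x \<partial>M) + (\<integral>x. g x \<partial>M) - 1 \<le> conv M f g x"
proof -
  have fc: "continuous_on UNIV f" and gc: "continuous_on UNIV g"
    and f01: "\<And>x. 0 \<le> f x" "\<And>x. f x \<le> 1" and g01: "\<And>x. 0 \<le> g x" "\<And>x. g x \<le> 1"
    using f g by auto
  have i: "integrable M (\<lambda>y. f (x - y) * g y)"
    by (rule integrable_convolution_kernel[OF fc gc])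
  have fr: "integrable M (\<lambda>y. f (x - y))"
    by (intro continuous_integrable continuous_intros continuous_on_compose2[OF fc]) auto
  note gi = continuous_integrable[OF gc]
  have R: "(\<integral>y. f (x - y) \<partial>M) = (\<integral>y. f y \<partial>M)" by (rule integral_reflect_translate[OF fc])
  show "0 \<le> conv M f g x" unfolding conv_def using f01 g01 by (intro integral_nonneg_AE) auto
  show "conv M f g x \<le> (\<integral>x. f x \<partial>M)" unfolding conv_def R[symmetric] using f01 g01
    by (intro integral_mono i fr mult_left_le) auto
  show "conv M f g x \<le> (\<integral>x. g x \<partial>M)" unfolding conv_def using f01 g01
    by (intro integral_mono i gi mult_left_le_one_le) auto
  have "(\<integral>x. f x \<partial>M) + (\<integral>x. g x \<partial>M) - 1 = (\<integral>y. f (x - y) + g y - 1 \<partial>M)"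
    using fr gi by (simp add: prob_space R)
  also have "\<dots> \<le> (\<integral>y. f (x - y) * g y \<partial>M)"
  proof (intro integral_mono i)
    show "integrable M (\<lambda>y. f (x - y) + g y - 1)" using fr gi by simp
    fix y
    have "0 \<le> (1 - f (x - y)) * (1 - g y)" using f01 g01 by (intro mult_nonneg_nonneg) auto
    then show "f (x - y) + g y - 1 \<le> f (x - y) * g y" by (simp add: algebra_simps)
  qed
  finally show "(\<integral>x. f x \<partial>M) + (\<integral>x. g x \<partial>M) - 1 \<le> conv M f g x" by (simp add: conv_def)
qed

lemma conv_translate:
  assumes f: "continuous_on UNIV f" and g: "continuous_on UNIV g"
  shows "conv M f (\<lambda>y. g (y + z)) x = conv M f g (x + z)"
proof -
  have "continuous_on UNIV (\<lambda>y. f (x + z - y) * g y)"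
    by (intro continuous_intros continuous_on_compose2[OF f] continuous_on_compose2[OF g]) auto
  from integral_translate[OF this, of z] show ?thesis
    unfolding conv_def by (simp add: algebra_simps)
qed

lemma conv_mono:
  assumes "f \<in> unit_functions" "continuous_on UNIV g" "continuous_on UNIV g'" "\<And>x. g x \<le> g' x"
  shows "conv M f g x \<le> conv M f g' x"
  unfolding conv_def using assms
  by (intro integral_mono integrable_convolution_kernel mult_left_mono) auto

lemma conv_add:
  assumes "continuous_on UNIV f" "continuous_on UNIV g" "continuous_on UNIV g'"
  shows "conv M f (\<lambda>y. g y + g' y) x = conv M f g x + conv M f g' x"
  unfolding conv_def using integrable_convolution_kernel[OF assms(1,2)]
    integrable_convolution_kernel[OF assms(1,3)] by (simp add: algebra_simps)

section \<open>Truncated mass of a convolution\<close>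

definition truncated_mass :: "('a \<Rightarrow> real) \<Rightarrow> real \<Rightarrow> ('a \<Rightarrow> real) \<Rightarrow> real" where
  "truncated_mass f t g = (\<integral>x. min (conv M f g x) t \<partial>M)"

lemma integrable_truncated:
  assumes "continuous_on UNIV f" "continuous_on UNIV g"
  shows "integrable M (\<lambda>x. min (conv M f g x) t)"
  by (intro continuous_integrable continuous_intros continuous_conv assms)

lemma truncated_mass_nonneg:
  assumes "f \<in> unit_functions" "g \<in> unit_functions" "0 \<le> t"
  shows "0 \<le> truncated_mass f t g"
  unfolding truncated_mass_def using conv_bounds(1)[OF assms(1,2)] assms(3)
  by (intro integral_nonneg_AE) auto

lemma truncated_mass_translate:
  assumes "continuous_on UNIV f" "continuous_on UNIV g"
  shows "truncated_mass f t (\<lambda>y. g (y + z)) = truncated_mass f t g"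
  unfolding truncated_mass_def conv_translate[OF assms]
  by (intro integral_translate continuous_intros continuous_conv assms)

text \<open>At each point the convolutions with \<open>g1\<close> and \<open>g2\<close> have the
  same sum as those with \<open>g\<close> and \<open>g'\<close> but lie further apart. Any
  \<open>g1\<close> below both functions is allowed, not just their minimum; this leaves room for
  products.\<close>

lemma truncated_mass_submodular:
  assumes f: "f \<in> unit_functions"
    and c: "continuous_on UNIV g" "continuous_on UNIV g'" "continuous_on UNIV g1" "continuous_on UNIV g2"
    and le: "\<And>x. g1 x \<le> g x" "\<And>x. g1 x \<le> g' x" and sum: "\<And>x. g1 x + g2 x = g x + g' x"
  shows "truncated_mass f t g1 + truncated_mass f t g2 \<le> truncated_mass f t g + truncated_mass f t g'"
proof -
  have fc: "continuous_on UNIV f" using f by simp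
  note i = integrable_truncated[OF fc c(1)] integrable_truncated[OF fc c(2)]
    integrable_truncated[OF fc c(3)] integrable_truncated[OF fc c(4)]
  have "min (conv M f g1 x) t + min (conv M f g2 x) t \<le> min (conv M f g x) t + min (conv M f g' x) t" for x
  proof -
    have "conv M f g1 x \<le> conv M f g x" "conv M f g1 x \<le> conv M f g' x"
      using le by (auto intro!: conv_mono f c)
    moreover have "conv M f g1 x + conv M f g2 x = conv M f g x + conv M f g' x"
      using conv_add[OF fc c(1,2)] conv_add[OF fc c(3,4)] by (simp add: sum)
    ultimately show ?thesis by (simp add: min_def)
  qed
  then have "(\<integral>x. min (conv M f g1 x) t + min (conv M f g2 x) t \<partial>M)
      \<le> (\<integral>x. min (conv M f g x) t + min (conv M f g' x) t \<partial>M)"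
    by (intro integral_mono Bochner_Integration.integrable_add i)
  then show ?thesis unfolding truncated_mass_def using i by simp
qed

text \<open>Fubini and translation invariance show that the average over \<open>z\<close> equals the
  square on the right. Compactness provides a minimising \<open>z\<close>, whose value is at most
  the average.\<close>

lemma exists_small_autocorrelation:
  fixes g :: "'a \<Rightarrow> real"
  assumes g: "continuous_on UNIV g"
  shows "\<exists>z. (\<integral>y. g y * g (y + z) \<partial>M) \<le> (\<integral>y. g y \<partial>M)\<^sup>2"
proof (rule ccontr)
  assume "\<not> ?thesis"
  then have gt: "(\<integral>y. g y * g (y + z) \<partial>M) > (\<integral>y. g y \<partial>M)\<^sup>2" for z
    by (meson not_le)
  have k: "continuous_on UNIV (\<lambda>(z, y). g y * g (y + z))"
    unfolding case_prod_beta
    by (intro continuous_intros continuous_on_compose2[OF g]) auto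
  note ck = continuous_parameter_integral[OF k]
  obtain z0 where z0: "\<And>z. (\<integral>y. g y * g (y + z0) \<partial>M) \<le> (\<integral>y. g y * g (y + z) \<partial>M)"
    using continuous_attains_inf[OF compact_space _ ck] by auto
  have "(\<integral>y. g y * g (y + z0) \<partial>M) = (\<integral>z. (\<integral>y. g y * g (y + z0) \<partial>M) \<partial>M)" by (simp add: prob_space)
  also have "\<dots> \<le> (\<integral>z. (\<integral>y. g y * g (y + z) \<partial>M) \<partial>M)"
    by (intro integral_mono continuous_integrable ck z0) auto
  also have "\<dots> = (\<integral>y. (\<integral>z. g y * g (y + z) \<partial>M) \<partial>M)" by (rule continuous_Fubini[OF k])
  also have "\<dots> = (\<integral>y. g y * (\<integral>z. g z \<partial>M) \<partial>M)"
    using integral_translate[OF g] by (simp add: add.commute)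
  also have "\<dots> = (\<integral>y. g y \<partial>M)\<^sup>2" by (simp add: power2_eq_square)
  finally show False using gt[of z0] by simp
qed

end

locale connected_compact_haar = compact_haar M for M :: "'a::topological_ab_group_add measure" +
  assumes connected_space: "connected (UNIV :: 'a set)"
begin

text \<open>
  For indicator functions the pair consists of the intersection and the union of a set and one of
  its translates.  For general \<open>g\<close> the minimum with a translate may have the same integral as \<open>g\<close>
  for every translate, and interpolating between the minimum and the product restores a
  continuum of values.
\<close>

lemma submodular_split:
  assumes f: "f \<in> unit_functions" and g: "g \<in> unit_functions"
    and b: "b = (\<integral>x. g x \<partial>M)" and s: "0 \<le> s" "s \<le> b - b\<^sup>2"
  obtains g1 g2 where "g1 \<in> unit_functions" "g2 \<in> unit_functions"
    "(\<integral>x. g1 x \<partial>M) = b - s" "(\<integral>x. g2 x \<partial>M) = b + s"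
    "truncated_mass f t g1 + truncated_mass f t g2 \<le> 2 * truncated_mass f t g"
proof -
  have fc: "continuous_on UNIV f" and gc: "continuous_on UNIV g"
    and g01: "\<And>x. 0 \<le> g x" "\<And>x. g x \<le> 1"
    using f g by auto
  have gz: "continuous_on UNIV (\<lambda>y. g (y + z))" for z
    by (intro continuous_intros continuous_on_compose2[OF gc]) auto
  \<comment> \<open>Minimum and product both lie between g y + g (y + z) - 1 and the minimum, hence
    so does every convex combination. This is what puts \<open>g1\<close> and \<open>g2\<close> into
    [0, 1].\<close>
  define w where "w \<theta> z y = (1 - \<theta>) * min (g y) (g (y + z)) + \<theta> * (g y * g (y + z))" for \<theta> z y
  have wc: "continuous_on UNIV (w \<theta> z)" for \<theta> z
    unfolding w_def[abs_def] by (intro continuous_intros gc gz)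
  \<comment> \<open>At \<open>z = 0\<close> the minimum has integral b and the product has the
    integral of g^2. If b - s lies between these two, \<open>z = 0\<close> is kept and \<theta>
    varies. Otherwise \<theta> = 1 and \<open>z\<close> varies: by connectedness the autocorrelation
    takes all values from the integral of g^2 down to some value at most b^2. This explains the
    bound on \<open>s\<close>.\<close>
  have "\<exists>\<theta> z. 0 \<le> \<theta> \<and> \<theta> \<le> 1 \<and> (\<integral>y. w \<theta> z y \<partial>M) = b - s"
  proof (cases "(\<integral>y. g y * g y \<partial>M) \<le> b - s")
    case True
    define q where "q = (\<integral>y. g y * g y \<partial>M)"
    have gi: "integrable M g" "integrable M (\<lambda>y. g y * g y)"
      by (intro continuous_integrable continuous_intros gc)+
    have int: "(\<integral>y. w \<theta> 0 y \<partial>M) = b - \<theta> * (b - q)" for \<theta>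
      unfolding w_def q_def b using gi by (simp add: algebra_simps)
    have q: "q \<le> b - s" using True by (simp add: q_def)
    \<comment> \<open>If \<open>q = b\<close>, then \<open>s = 0\<close> and \<theta> = 0 serves, so
      the quotient below is never formed with denominator 0.\<close>
    show ?thesis
    proof (cases "q = b")
      case True
      with q s int[of 0] show ?thesis by (intro exI[of _ 0]) auto
    next
      case False
      with q s have "q < b" by simp
      then have "(\<integral>y. w (s / (b - q)) 0 y \<partial>M) = b - s" using int[of "s / (b - q)"] by simp
      moreover have "0 \<le> s / (b - q)" "s / (b - q) \<le> 1" using \<open>q < b\<close> q s by auto
      ultimately show ?thesis by blast
    qed
  next
    case False
    have k: "continuous_on UNIV (\<lambda>(z, y). g y * g (y + z))"
      unfolding case_prod_beta
      by (intro continuous_intros continuous_on_compose2[OF gc]) auto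
    have "connected (range (\<lambda>z. \<integral>y. g y * g (y + z) \<partial>M))"
      by (intro connected_continuous_image continuous_parameter_integral k connected_space)
    moreover obtain z0 where "(\<integral>y. g y * g (y + z0) \<partial>M) \<le> b\<^sup>2"
      using exists_small_autocorrelation[OF gc] b by auto
    then have "(\<integral>y. g y * g (y + z0) \<partial>M) \<le> b - s" using s by simp
    moreover have "b - s \<le> (\<integral>y. g y * g (y + 0) \<partial>M)" using False by simp
    ultimately have "b - s \<in> range (\<lambda>z. \<integral>y. g y * g (y + z) \<partial>M)"
      unfolding connected_iff_interval by blast
    then obtain z where "(\<integral>y. g y * g (y + z) \<partial>M) = b - s" by auto
    then show ?thesis by (intro exI[of _ 1] exI[of _ z]) (simp add: w_def)
  qed
  then obtain \<theta> z where th: "0 \<le> \<theta>" "\<theta> \<le> 1" and int: "(\<integral>y. w \<theta> z y \<partial>M) = b - s" by blast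
  define g1 where "g1 = w \<theta> z"
  define g2 where "g2 y = g y + g (y + z) - g1 y" for y
  have prods: "0 \<le> g y * g (y + z)" "g y * g (y + z) \<le> g y" "g y * g (y + z) \<le> g (y + z)"
    "0 \<le> (1 - g y) * (1 - g (y + z))" for y
    using g01 by (auto intro: mult_left_le mult_left_le_one_le)
  have g1_le: "0 \<le> g1 y" "g1 y \<le> g y" "g1 y \<le> g (y + z)" for y
  proof -
    have "g1 y \<le> (1 - \<theta>) * min (g y) (g (y + z)) + \<theta> * min (g y) (g (y + z))"
      unfolding g1_def w_def using th prods by (intro add_left_mono mult_left_mono) auto
    then have "g1 y \<le> min (g y) (g (y + z))" by (simp add: algebra_simps)
    then show "g1 y \<le> g y" "g1 y \<le> g (y + z)" by auto
    show "0 \<le> g1 y" unfolding g1_def w_def using th prods g01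
      by (intro add_nonneg_nonneg mult_nonneg_nonneg) auto
  qed
  have g2_le: "0 \<le> g2 y" "g2 y \<le> 1" for y
  proof -
    show "0 \<le> g2 y" using g1_le[of y] g01[of "y + z"] by (simp add: g2_def)
    have m: "g y + g (y + z) - 1 \<le> g y * g (y + z)" using prods(4)[of y] by (simp add: algebra_simps)
    have "(1 - \<theta>) * (g y + g (y + z) - 1) + \<theta> * (g y + g (y + z) - 1) \<le> g1 y"
      unfolding g1_def w_def using th m g01(2)[of y] g01(2)[of "y + z"]
      by (intro add_mono mult_left_mono) auto
    then show "g2 y \<le> 1" by (simp add: g2_def algebra_simps)
  qed
  have g1c: "continuous_on UNIV g1" unfolding g1_def by (rule wc)
  have g2c: "continuous_on UNIV g2" unfolding g2_def[abs_def] by (intro continuous_intros gc gz g1c)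
  show thesis
  proof (rule that)
    show "g1 \<in> unit_functions" using g1c g1_le g01 order_trans by (fastforce intro: order_trans)
    show "g2 \<in> unit_functions" using g2c g2_le by simp
    show "(\<integral>x. g1 x \<partial>M) = b - s" using int by (simp add: g1_def)
    then show "(\<integral>x. g2 x \<partial>M) = b + s"
      unfolding g2_def using continuous_integrable[OF gc] continuous_integrable[OF gz]
        continuous_integrable[OF g1c] integral_translate[OF gc] b by simp
    show "truncated_mass f t g1 + truncated_mass f t g2 \<le> 2 * truncated_mass f t g"
      using truncated_mass_submodular[OF f gc gz g1c g2c, of z t] g1_le
        truncated_mass_translate[OF fc gc, of t z] by (simp add: g2_def)
  qed
qed

end

section \<open>The Pollard-type inequality\<close>

text \<open>The midpoint inequality is given at just one scale \<open>s\<close> per point, so a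
  minimum principle is used. Adding a small multiple of the strictly concave (y - p) (q - y), which
  vanishes at the ends, makes the inequality strict; this is impossible at an interior
  minimum.\<close>

lemma locally_midconcave_nonneg:
  fixes D :: "real \<Rightarrow> real"
  assumes cont: "continuous_on {p..q} D" and ends: "0 \<le> D p" "0 \<le> D q"
    and mid: "\<And>b. p < b \<Longrightarrow> b < q \<Longrightarrow> \<exists>s>0. p \<le> b - s \<and> b + s \<le> q \<and> D (b - s) + D (b + s) \<le> 2 * D b"
    and x: "p \<le> x" "x \<le> q"
  shows "0 \<le> D x"
proof (rule ccontr)
  assume "\<not> 0 \<le> D x"
  then have neg: "D x < 0" by simp
  with ends x have "p < x" "x < q" by (auto simp: less_le)
  then have pos: "(x - p) * (q - x) > 0" by simp
  define P where "P = (x - p) * (q - x)"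
  \<comment> \<open>With this \<open>e\<close> the added term at \<open>x\<close> is half of the
    absolute value of D x, so \<open>D'\<close> is still negative there.\<close>
  define e where "e = - D x / (2 * P)"
  have P: "P > 0" using pos by (simp add: P_def)
  then have e: "e > 0" unfolding e_def using neg by (intro divide_pos_pos) auto
  define D' where "D' y = D y + e * ((y - p) * (q - y))" for y
  have "continuous_on {p..q} D'" unfolding D'_def[abs_def] by (intro continuous_intros cont)
  then obtain b where b: "b \<in> {p..q}" "\<And>y. y \<in> {p..q} \<Longrightarrow> D' b \<le> D' y"
    using continuous_attains_inf[of "{p..q}" D'] x by auto
  have "e * P = - D x / 2" using P by (simp add: e_def)
  then have "D' x < 0" using neg by (simp add: D'_def P_def)
  with b(2)[of x] x have "D' b < 0" by auto
  moreover have "D' p \<ge> 0" "D' q \<ge> 0" using ends by (auto simp: D'_def)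
  ultimately have "p < b" "b < q" using b(1) by (auto simp: less_le)
  then obtain s where s: "s > 0" "p \<le> b - s" "b + s \<le> q" "D (b - s) + D (b + s) \<le> 2 * D b"
    using mid by blast
  have "D' (b - s) + D' (b + s) = D (b - s) + D (b + s) + 2 * (e * ((b - p) * (q - b))) - 2 * e * s\<^sup>2"
    by (simp add: D'_def algebra_simps power2_eq_square)
  also have "\<dots> \<le> 2 * D' b - 2 * e * s\<^sup>2" using s(4) by (simp add: D'_def)
  also have "\<dots> < 2 * D' b" using e s(1) by simp
  finally show False using b(2)[of "b - s"] b(2)[of "b + s"] s b(1) by auto
qed

section \<open>The least truncated mass as a function of the integral\<close>

context compact_haar
begin

text \<open>A real infimum, to be read for 0 \<le> b \<le> 1 and 0 \<le> t: constant functions then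
  make the index set nonempty, and 0 is a lower bound.\<close>

definition least_truncated_mass :: "('a \<Rightarrow> real) \<Rightarrow> real \<Rightarrow> real \<Rightarrow> real" where
  "least_truncated_mass f t b = (INF g\<in>{g \<in> unit_functions. (\<integral>x. g x \<partial>M) = b}. truncated_mass f t g)"

lemma unit_integral_bounds:
  assumes "g \<in> unit_functions"
  shows "0 \<le> (\<integral>x. g x \<partial>M)" "(\<integral>x. g x \<partial>M) \<le> 1"
proof -
  show "0 \<le> (\<integral>x. g x \<partial>M)" using assms by (intro integral_nonneg_AE) auto
  have "(\<integral>x. g x \<partial>M) \<le> (\<integral>x. 1 \<partial>M)"
    using assms by (intro integral_mono continuous_integrable) auto
  then show "(\<integral>x. g x \<partial>M) \<le> 1" by (simp add: prob_space)
qed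

lemma least_truncated_mass_le:
  assumes "f \<in> unit_functions" "0 \<le> t" "g \<in> unit_functions" "(\<integral>x. g x \<partial>M) = b"
  shows "least_truncated_mass f t b \<le> truncated_mass f t g"
  unfolding least_truncated_mass_def
  by (rule cINF_lower) (use assms truncated_mass_nonneg in \<open>auto intro!: bdd_belowI2[where m = 0]\<close>)

lemma least_truncated_mass_greatest:
  assumes "0 \<le> b" "b \<le> 1"
    and "\<And>g. g \<in> unit_functions \<Longrightarrow> (\<integral>x. g x \<partial>M) = b \<Longrightarrow> c \<le> truncated_mass f t g"
  shows "c \<le> least_truncated_mass f t b"
  unfolding least_truncated_mass_def
proof (rule cINF_greatest)
  have "(\<lambda>_. b) \<in> {g \<in> unit_functions. (\<integral>x. g x \<partial>M) = b}" using assms by (simp add: prob_space)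
  then show "{g \<in> unit_functions. (\<integral>x. g x \<partial>M) = b} \<noteq> {}" by blast
qed (use assms in auto)

text \<open>A scalar multiple suffices. The pointwise comparison serves twice: for relating infima
  at different integrals, and for correcting the integral of an approximating function at the least
  L1 cost.\<close>

lemma unit_function_shrink:
  assumes g: "g \<in> unit_functions" and gb: "(\<integral>x. g x \<partial>M) = b'" and b: "0 \<le> b" "b \<le> b'"
  obtains g' where "g' \<in> unit_functions" "(\<integral>x. g' x \<partial>M) = b" "\<And>x. g' x \<le> g x"
proof -
  \<comment> \<open>For \<open>b' = 0\<close> the quotient is 0 by convention; \<open>g'\<close> is
    then zero, in agreement with \<open>b = 0\<close>.\<close>
  have r: "0 \<le> b / b'" "b / b' \<le> 1" using b by (auto simp: divide_le_eq)
  have gr: "b / b' * g x \<le> g x" "0 \<le> g x" for x using mult_left_le_one_le[OF _ r, of "g x"] g by auto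
  define g' where "g' x = b / b' * g x" for x
  have g'c: "continuous_on UNIV g'"
    unfolding g'_def[abs_def] using g by (intro continuous_on_mult continuous_on_const) auto
  have "0 \<le> g' x" "g' x \<le> 1" for x
    using gr[of x] g mult_nonneg_nonneg[OF r(1), of "g x"] by (auto simp: g'_def intro: order_trans)
  then have "g' \<in> unit_functions" using g'c by simp
  moreover have "(\<integral>x. g' x \<partial>M) = b" using b by (cases "b' = 0") (simp_all add: g'_def gb)
  moreover have "g' x \<le> g x" for x using gr by (simp add: g'_def)
  ultimately show thesis by (rule that)
qed

lemma unit_function_grow:
  assumes g: "g \<in> unit_functions" and gb: "(\<integral>x. g x \<partial>M) = b" and b: "b \<le> b'" "b' \<le> 1"
  obtains g' where "g' \<in> unit_functions" "(\<integral>x. g' x \<partial>M) = b'" "\<And>x. g x \<le> g' x"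
proof -
  have gc: "continuous_on UNIV (\<lambda>x. 1 - g x)" using g by (auto intro: continuous_on_diff)
  have gi: "integrable M g" using g by (auto intro: continuous_integrable)
  have "(\<lambda>x. 1 - g x) \<in> unit_functions" using g gc by auto
  moreover have "(\<integral>x. 1 - g x \<partial>M) = 1 - b" using gi gb by (simp add: prob_space)
  ultimately obtain u where u: "u \<in> unit_functions" "(\<integral>x. u x \<partial>M) = 1 - b'" "\<And>x. u x \<le> 1 - g x"
    using unit_function_shrink[of "\<lambda>x. 1 - g x" "1 - b" "1 - b'"] b by auto
  have "integrable M u" using u by (auto intro: continuous_integrable)
  then have int: "(\<integral>x. 1 - u x \<partial>M) = b'" using u by (simp add: prob_space)
  have "(\<lambda>x. 1 - u x) \<in> unit_functions" using u by (auto intro: continuous_on_diff)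
  moreover note int
  moreover have "g x \<le> 1 - u x" for x using u(3)[of x] by simp
  ultimately show thesis by (rule that)
qed

lemma least_truncated_mass_mono:
  assumes f: "f \<in> unit_functions" and t: "0 \<le> t" and b: "0 \<le> b" "b \<le> b'" "b' \<le> 1"
  shows "least_truncated_mass f t b \<le> least_truncated_mass f t b'"
proof (rule least_truncated_mass_greatest)
  fix g assume g: "g \<in> unit_functions" and gb: "(\<integral>x. g x \<partial>M) = b'"
  obtain g' where g': "g' \<in> unit_functions" "(\<integral>x. g' x \<partial>M) = b" "\<And>x. g' x \<le> g x"
    using unit_function_shrink[OF g gb b(1,2)] by blast
  then have "least_truncated_mass f t b \<le> truncated_mass f t g'"
    using f t by (intro least_truncated_mass_le)
  also have "\<dots> \<le> truncated_mass f t g"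
    unfolding truncated_mass_def using f g g'
    by (intro integral_mono integrable_truncated min.mono conv_mono) auto
  finally show "least_truncated_mass f t b \<le> truncated_mass f t g" .
qed (use b in auto)

text \<open>Enlarging \<open>g\<close> by \<open>d\<close> raises the truncated convolution by at
  most \<open>conv M f d\<close>, whose integral is that of \<open>f\<close> times that of
  \<open>d\<close>. With monotonicity this makes the infimum 1-Lipschitz.\<close>

lemma least_truncated_mass_growth:
  assumes f: "f \<in> unit_functions" and t: "0 \<le> t" and b: "0 \<le> b" "b \<le> b'" "b' \<le> 1"
  shows "least_truncated_mass f t b' \<le> least_truncated_mass f t b + (b' - b)"
proof -
  have "least_truncated_mass f t b' - (b' - b) \<le> least_truncated_mass f t b"
  proof (rule least_truncated_mass_greatest)
    fix g assume g: "g \<in> unit_functions" and gb: "(\<integral>x. g x \<partial>M) = b"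
    obtain g' where g': "g' \<in> unit_functions" "(\<integral>x. g' x \<partial>M) = b'" "\<And>x. g x \<le> g' x"
      using unit_function_grow[OF g gb b(2,3)] by blast
    define d where "d x = g' x - g x" for x
    have gc: "continuous_on UNIV g" and fc: "continuous_on UNIV f" and g'c: "continuous_on UNIV g'"
      using g f g' by auto
    have dc: "continuous_on UNIV d" unfolding d_def[abs_def] by (intro continuous_intros gc g'c)
    have d: "0 \<le> d x" for x using g'(3) by (simp add: d_def)
    have dint: "(\<integral>x. d x \<partial>M) = b' - b"
      unfolding d_def using continuous_integrable[OF gc] continuous_integrable[OF g'c] gb g'(2) by simp
    have "least_truncated_mass f t b' \<le> truncated_mass f t g'"
      using f t g' by (intro least_truncated_mass_le)
    also have "\<dots> \<le> (\<integral>x. min (conv M f g x) t + conv M f d x \<partial>M)"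
      unfolding truncated_mass_def
    proof (intro integral_mono integrable_truncated fc g'c Bochner_Integration.integrable_add gc)
      show "integrable M (conv M f d)" by (intro continuous_integrable continuous_conv fc dc)
      fix x
      have "0 \<le> conv M f d x" using f d unfolding conv_def by (intro integral_nonneg_AE) auto
      moreover have "conv M f g' x = conv M f g x + conv M f d x"
        using conv_add[OF fc gc dc, of x] by (simp add: d_def)
      ultimately show "min (conv M f g' x) t \<le> min (conv M f g x) t + conv M f d x" by simp
    qed
    also have "\<dots> = truncated_mass f t g + (\<integral>x. f x \<partial>M) * (b' - b)"
      unfolding truncated_mass_def using integrable_truncated[OF fc gc]
        continuous_integrable[OF continuous_conv[OF fc dc]] integral_conv[OF fc dc] by (simp add: dint)
    also have "\<dots> \<le> truncated_mass f t g + (b' - b)"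
      using unit_integral_bounds[OF f] b by (intro add_left_mono mult_left_le_one_le) auto
    finally show "least_truncated_mass f t b' - (b' - b) \<le> truncated_mass f t g" by simp
  qed (use b in auto)
  then show ?thesis by simp
qed

lemma continuous_least_truncated_mass:
  assumes f: "f \<in> unit_functions" and t: "0 \<le> t"
  shows "continuous_on {0..1} (least_truncated_mass f t)"
proof -
  have "\<bar>least_truncated_mass f t b - least_truncated_mass f t b'\<bar> \<le> \<bar>b - b'\<bar>"
    if "b \<in> {0..1}" "b' \<in> {0..1}" for b b'
    using that least_truncated_mass_mono[OF f t, of b b'] least_truncated_mass_mono[OF f t, of b' b]
      least_truncated_mass_growth[OF f t, of b b'] least_truncated_mass_growth[OF f t, of b' b]
    by (cases "b \<le> b'") auto
  then show ?thesis unfolding continuous_on_iff dist_real_def by (meson le_less_trans)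
qed

end

context connected_compact_haar
begin

text \<open>
  The least truncated mass is concave in \<open>b\<close>, and at the two ends of the interval
  \<open>t \<le> b \<le> 1 + t - a\<close> it agrees with the affine function \<open>t * (a + b - t)\<close>.
\<close>

lemma truncated_mass_lower_bound:
  assumes f: "f \<in> unit_functions" and g: "g \<in> unit_functions" and t: "0 \<le> t"
    and a: "a = (\<integral>x. f x \<partial>M)" and b: "b = (\<integral>x. g x \<partial>M)"
    and tab: "t \<le> a" "t \<le> b" "a + b - t \<le> 1"
  shows "t * (a + b - t) \<le> truncated_mass f t g"
proof -
  have fc: "continuous_on UNIV f" using f by simp
  have a1: "0 \<le> a" "a \<le> 1" using unit_integral_bounds[OF f] a by auto
  define D where "D x = least_truncated_mass f t x - t * (a + x - t)" for x
  have "0 \<le> D b"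
  proof (rule locally_midconcave_nonneg[where D = D and p = t and q = "1 + t - a"])
    show "continuous_on {t..1 + t - a} D" unfolding D_def[abs_def] using a1 t tab
      by (intro continuous_intros continuous_on_subset[OF continuous_least_truncated_mass[OF f t]]) auto
    show "0 \<le> D t"
    proof -
      have "t * a \<le> least_truncated_mass f t t"
      proof (rule least_truncated_mass_greatest)
        fix u assume u: "u \<in> unit_functions" and ut: "(\<integral>x. u x \<partial>M) = t"
        have "min (conv M f u x) t = conv M f u x" for x
          using conv_bounds(3)[OF f u, of x] ut by simp
        then show "t * a \<le> truncated_mass f t u"
          unfolding truncated_mass_def using u by (simp add: integral_conv[OF fc] ut a)
      qed (use t tab a1 in auto)
      then show ?thesis by (simp add: D_def)
    qed
    show "0 \<le> D (1 + t - a)"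
    proof -
      have "t \<le> least_truncated_mass f t (1 + t - a)"
      proof (rule least_truncated_mass_greatest)
        fix u assume u: "u \<in> unit_functions" and ut: "(\<integral>x. u x \<partial>M) = 1 + t - a"
        have "min (conv M f u x) t = t" for x
          using conv_bounds(4)[OF f u, of x] ut a by simp
        then show "t \<le> truncated_mass f t u"
          unfolding truncated_mass_def by (simp add: prob_space)
      qed (use t tab a1 in auto)
      then show ?thesis by (simp add: D_def)
    qed
    show "\<exists>s>0. t \<le> x - s \<and> x + s \<le> 1 + t - a \<and> D (x - s) + D (x + s) \<le> 2 * D x"
      if x: "t < x" "x < 1 + t - a" for x
    proof -
      have x01: "0 < x" "x < 1" using x t tab by auto
      then have "x - x\<^sup>2 > 0" by (simp add: power2_eq_square)
      \<comment> \<open>The first term is the reach of the split; the other two keep x - s and x + s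
        inside the range. The first is positive because 0 \<le> t < x and x < 1 + t - a \<le>
        1.\<close>
      define s where "s = min (x - x\<^sup>2) (min (x - t) (1 + t - a - x))"
      have s: "s > 0" "s \<le> x - x\<^sup>2" "t \<le> x - s" "x + s \<le> 1 + t - a"
        using x \<open>x - x\<^sup>2 > 0\<close> by (auto simp: s_def)
      have "(least_truncated_mass f t (x - s) + least_truncated_mass f t (x + s)) / 2
          \<le> least_truncated_mass f t x"
      proof (rule least_truncated_mass_greatest)
        fix u assume u: "u \<in> unit_functions" and ux: "(\<integral>y. u y \<partial>M) = x"
        obtain u1 u2 where "u1 \<in> unit_functions" "u2 \<in> unit_functions"
          "(\<integral>y. u1 y \<partial>M) = x - s" "(\<integral>y. u2 y \<partial>M) = x + s"
          "truncated_mass f t u1 + truncated_mass f t u2 \<le> 2 * truncated_mass f t u"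
          using submodular_split[OF f u ux[symmetric], of s t] s by auto
        then show "(least_truncated_mass f t (x - s) + least_truncated_mass f t (x + s)) / 2
            \<le> truncated_mass f t u"
          using least_truncated_mass_le[OF f t, of u1 "x - s"]
            least_truncated_mass_le[OF f t, of u2 "x + s"] by simp
      qed (use x01 in auto)
      then have "D (x - s) + D (x + s) \<le> 2 * D x" by (simp add: D_def algebra_simps)
      with s show ?thesis by blast
    qed
  qed (use tab in auto)
  then show ?thesis
    using least_truncated_mass_le[OF f t g, of b] b by (simp add: D_def)
qed

text \<open>The excess over \<open>t\<close> is paired with \<open>h\<close> \<le> 1, the truncated
  part with its upper bound \<open>t\<close>, which contributes t c.\<close>

lemma pairing_conv_continuous_le:
  assumes f: "f \<in> unit_functions" and g: "g \<in> unit_functions" and h: "h \<in> unit_functions"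
    and t: "0 \<le> t"
    and a: "a = (\<integral>x. f x \<partial>M)" and b: "b = (\<integral>x. g x \<partial>M)" and c: "c = (\<integral>x. h x \<partial>M)"
    and tab: "t \<le> a" "t \<le> b" "a + b - t \<le> 1"
  shows "pairing M (conv M f g) h \<le> a * b - t * (a + b - t) + t * c"
proof -
  have fc: "continuous_on UNIV f" and gc: "continuous_on UNIV g" and hc: "continuous_on UNIV h"
    using f g h by auto
  note cc = continuous_conv[OF fc gc]
  have "pairing M (conv M f g) h \<le> (\<integral>x. conv M f g x - min (conv M f g x) t + t * h x \<partial>M)"
    unfolding pairing_def
  proof (intro integral_mono continuous_integrable continuous_intros cc hc)
    fix x
    have h01: "0 \<le> h x" "h x \<le> 1" using h by auto
    have "(conv M f g x - min (conv M f g x) t) * h x \<le> conv M f g x - min (conv M f g x) t"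
      using h01 by (intro mult_left_le) auto
    moreover have "min (conv M f g x) t * h x \<le> t * h x"
      using h01 by (intro mult_right_mono) auto
    ultimately show "conv M f g x * h x \<le> conv M f g x - min (conv M f g x) t + t * h x"
      by (simp add: algebra_simps)
  qed
  also have "\<dots> = a * b - truncated_mass f t g + t * c"
    unfolding truncated_mass_def using continuous_integrable[OF cc] continuous_integrable[OF hc]
      integrable_truncated[OF fc gc, of t] integral_conv[OF fc gc] by (simp add: a b c)
  finally show ?thesis using truncated_mass_lower_bound[OF f g t a b tab] by simp
qed

end

section \<open>Measurable functions\<close>

text \<open>Continuity of (u, v) \<mapsto> a + u - v at the origin gives neighbourhoods
  \<open>A\<close>, \<open>B\<close> of 0 for which a + A - B misses \<open>C\<close>; then a + A
  and C + B are disjoint. Compact regular spaces are normal, which gives Urysohn functions without a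
  Hausdorff assumption.\<close>

lemma topological_group_regular_space:
  "regular_space (euclidean :: 'a::topological_ab_group_add topology)"
  unfolding regular_space_def
proof (intro allI impI)
  fix C :: "'a set" and a
  assume "closedin euclidean C \<and> a \<in> topspace euclidean - C"
  then have C: "open (- C)" "a \<in> - C" by auto
  have "continuous_on UNIV (\<lambda>(u, v). a + u - v)"
    unfolding case_prod_beta by (intro continuous_intros)
  then have "open ((\<lambda>(u, v). a + u - v) -` (- C))" by (rule open_vimage[OF C(1)])
  moreover have "(0, 0) \<in> (\<lambda>(u, v). a + u - v) -` (- C)" using C(2) by simp
  ultimately obtain A B where AB: "open A" "open B" "0 \<in> A" "0 \<in> B"
    "A \<times> B \<subseteq> (\<lambda>(u, v). a + u - v) -` (- C)"
    by (elim open_prod_elim) auto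
  have AB': "a + u - v \<notin> C" if "u \<in> A" "v \<in> B" for u v using AB(5) that by auto
  define U where "U = (\<lambda>x. x - a) -` A"
  define V where "V = (\<Union>c\<in>C. (\<lambda>x. x - c) -` B)"
  have "open U" unfolding U_def by (intro open_vimage AB continuous_intros)
  moreover have "open V" unfolding V_def by (intro open_UN ballI open_vimage AB continuous_intros)
  moreover have "a \<in> U" "C \<subseteq> V" using AB by (auto simp: U_def V_def)
  moreover have "disjnt U V"
  proof -
    have "c \<notin> C" if "x - a \<in> A" "x - c \<in> B" for x c
      using AB'[OF that] by simp
    then show ?thesis by (auto simp: disjnt_iff U_def V_def)
  qed
  ultimately show "\<exists>U V. openin euclidean U \<and> openin euclidean V \<and> a \<in> U \<and> C \<subseteq> V \<and> disjnt U V"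
    by (auto simp: open_openin[symmetric])
qed

locale regular_compact_haar = compact_haar M for M :: "'a::topological_ab_group_add measure" +
  assumes outer_regular:
    "\<And>E. E \<in> sets borel \<Longrightarrow> emeasure M E = (INF U\<in>{U. open U \<and> E \<subseteq> U}. emeasure M U)"
begin

lemma exists_open_superset:
  assumes E: "E \<in> sets borel" and e: "0 < e"
  obtains U where "open U" "E \<subseteq> U" "measure M U < measure M E + e"
proof -
  have "(INF U\<in>{U. open U \<and> E \<subseteq> U}. emeasure M U) < emeasure M E + ennreal e"
    using e unfolding outer_regular[OF E, symmetric] by (simp add: emeasure_eq_measure ennreal_less_iff flip: ennreal_plus)
  then obtain U where U: "open U" "E \<subseteq> U" "emeasure M U < emeasure M E + ennreal e"
    unfolding INF_less_iff by auto
  then have "measure M U < measure M E + e"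
    using e by (simp add: emeasure_eq_measure ennreal_less_iff flip: ennreal_plus)
  with U that show thesis by blast
qed

lemma exists_closed_subset:
  assumes E: "E \<in> sets borel" and e: "0 < e"
  obtains F where "closed F" "F \<subseteq> E" "measure M E - e < measure M F"
proof -
  have "- E \<in> sets borel" using E by (metis borel_comp)
  then obtain U where U: "open U" "- E \<subseteq> U" "measure M U < measure M (- E) + e"
    using exists_open_superset e by blast
  have "measure M (- E) = 1 - measure M E" "measure M (- U) = 1 - measure M U"
    using prob_compl[of E] prob_compl[of U] E U(1) by (auto simp: sets_borel space_UNIV Compl_eq_Diff_UNIV)
  with U that[of "- U"] show thesis by auto
qed

lemma Urysohn_unit_function:
  assumes "closed F" "open U" "F \<subseteq> U"
  obtains \<phi> where "\<phi> \<in> unit_functions" "\<And>x. x \<in> F \<Longrightarrow> \<phi> x = 1" "\<And>x. x \<notin> U \<Longrightarrow> \<phi> x = 0"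
proof -
  have "normal_space (euclidean :: 'a topology)"
    using compact_space topological_group_regular_space
    by (intro compact_Hausdorff_or_regular_imp_normal_space) (auto simp: compact_space_def)
  moreover have "closedin euclidean (- U)" "closedin euclidean F" "disjnt (- U) F"
    using assms by (auto simp: disjnt_iff)
  ultimately obtain \<phi> where \<phi>: "continuous_map euclidean (top_of_set {0..1::real}) \<phi>"
    "\<phi> ` (- U) \<subseteq> {0}" "\<phi> ` F \<subseteq> {1}"
    using Urysohn_lemma[of euclidean "- U" F 0 1] by auto
  have "continuous_on UNIV \<phi>" "\<phi> x \<in> {0..1}" for x
    using \<phi>(1) by (auto simp: continuous_map_in_subtopology)
  with \<phi>(2,3) that[of \<phi>] show thesis by fastforce
qed

text \<open>
  Continuous functions have reflection invariant integrals.  For Borel sets, compare a closed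
  subset of \<open>x - E\<close> with an open superset of \<open>E\<close> through a Urysohn function.
\<close>

lemma measure_reflect_le:
  assumes E: "E \<in> sets borel"
  shows "measure M ((\<lambda>y. x - y) -` E) \<le> measure M E"
proof (rule field_le_epsilon)
  fix e :: real assume e: "0 < e"
  have refl: "(\<lambda>y. x - y) \<in> borel_measurable borel"
    by (intro borel_measurable_continuous_onI continuous_intros)
  have E': "(\<lambda>y. x - y) -` E \<in> sets borel"
    using measurable_sets[OF refl E] by simp
  have "0 < e / 2" using e by simp
  obtain F where F: "closed F" "F \<subseteq> (\<lambda>y. x - y) -` E"
    "measure M ((\<lambda>y. x - y) -` E) - e / 2 < measure M F"
    using exists_closed_subset[OF E' \<open>0 < e / 2\<close>] by blast
  obtain U where U: "open U" "E \<subseteq> U" "measure M U < measure M E + e / 2"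
    using exists_open_superset[OF E \<open>0 < e / 2\<close>] by blast
  define F' where "F' = (\<lambda>y. x - y) -` F"
  have "closed F'" unfolding F'_def by (intro closed_vimage F continuous_intros)
  moreover have "F' \<subseteq> U" using F(2) U(2) by (auto simp: F'_def)
  ultimately obtain \<phi> where \<phi>: "\<phi> \<in> unit_functions" "\<And>x. x \<in> F' \<Longrightarrow> \<phi> x = 1" "\<And>x. x \<notin> U \<Longrightarrow> \<phi> x = 0"
    using Urysohn_unit_function U(1) by blast
  have \<phi>c: "continuous_on UNIV \<phi>" using \<phi>(1) by simp
  have Fm: "F \<in> sets M" "U \<in> sets M" using F U by (auto simp: sets_borel)
  have "measure M F = (\<integral>y. indicat_real F y \<partial>M)" by (simp add: space_UNIV)
  also have "\<dots> \<le> (\<integral>y. \<phi> (x - y) \<partial>M)"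
  proof (intro integral_mono)
    show "integrable M (indicat_real F)" using Fm by (intro integrable_real_indicator) (auto simp: less_top[symmetric])
    show "integrable M (\<lambda>y. \<phi> (x - y))"
      by (intro continuous_integrable continuous_on_compose2[OF \<phi>c] continuous_intros) auto
    show "indicat_real F y \<le> \<phi> (x - y)" for y
      using \<phi>(1) \<phi>(2)[of "x - y"] by (auto simp: indicator_def F'_def)
  qed
  also have "\<dots> = (\<integral>y. \<phi> y \<partial>M)" by (rule integral_reflect_translate[OF \<phi>c])
  also have "\<dots> \<le> (\<integral>y. indicat_real U y \<partial>M)"
  proof (rule integral_mono)
    show "integrable M \<phi>" by (rule continuous_integrable[OF \<phi>c])
    show "integrable M (indicat_real U)" using Fm by (intro integrable_real_indicator) (auto simp: less_top[symmetric])
    show "\<phi> y \<le> indicat_real U y" for y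
      using \<phi>(1) \<phi>(3)[of y] by (auto simp: indicator_def)
  qed
  also have "\<dots> = measure M U" by (simp add: space_UNIV)
  finally show "measure M ((\<lambda>y. x - y) -` E) \<le> measure M E + e" using F U by simp
qed

lemma distr_reflect: "distr M M (\<lambda>y. x - y) = M"
proof (rule measure_eqI)
  show "sets (distr M M (\<lambda>y. x - y)) = sets M" by simp
  fix E assume "E \<in> sets (distr M M (\<lambda>y. x - y))"
  then have E: "E \<in> sets borel" by (simp add: sets_borel)
  have m: "(\<lambda>y. x - y) \<in> measurable M M"
    by (intro continuous_measurable_self continuous_intros)
  have E': "(\<lambda>y. x - y) -` E \<in> sets borel"
    using measurable_sets[OF m, of E] E by (simp add: sets_borel space_UNIV)
  \<comment> \<open>The reflection is an involution, so the inequality for the reflected set is the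
    reverse inequality for \<open>E\<close>.\<close>
  have "(\<lambda>y. x - y) -` (\<lambda>y. x - y) -` E = E" by auto
  then have "measure M ((\<lambda>y. x - y) -` E) = measure M E"
    using measure_reflect_le[OF E, of x] measure_reflect_le[OF E', of x] by simp
  then show "emeasure (distr M M (\<lambda>y. x - y)) E = emeasure M E"
    using E by (simp add: emeasure_distr[OF m] space_UNIV sets_borel emeasure_eq_measure)
qed

text \<open>A measure preserving map pulls null sets back to null sets, hence stays measurable
  between completions. This makes y \<mapsto> f (x - y) measurable when \<open>f\<close> is
  measurable only for the completed measure.\<close>

lemma completion_reflect:
  shows "(\<lambda>y. x - y) \<in> measurable (completion M) (completion M)"
    and "distr (completion M) (completion M) (\<lambda>y. x - y) = completion M"
proof -
  have m: "(\<lambda>y. x - y) \<in> measurable M M"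
    by (intro continuous_measurable_self continuous_intros)
  note m' = measurable_completion[OF m]
  have d: "distr (completion M) M (\<lambda>y. x - y) = M"
    using distr_completion[OF m] distr_reflect by simp
  show "distr (completion M) (completion M) (\<lambda>y. x - y) = completion M"
    using completion.completion_distr_eq[OF m'] d by simp
  show "(\<lambda>y. x - y) \<in> measurable (completion M) (completion M)"
    using completion.measurable_completion2[OF m'] d by simp
qed

lemma integral_completion_reflect:
  fixes k :: "'a \<Rightarrow> real"
  assumes "k \<in> borel_measurable (completion M)"
  shows "(\<lambda>y. k (x - y)) \<in> borel_measurable (completion M)"
    and "(\<integral>y. k (x - y) \<partial>completion M) = (\<integral>y. k y \<partial>completion M)"
proof -
  show "(\<lambda>y. k (x - y)) \<in> borel_measurable (completion M)"
    using measurable_compose[OF completion_reflect(1) assms] .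
  show "(\<integral>y. k (x - y) \<partial>completion M) = (\<integral>y. k y \<partial>completion M)"
    using integral_distr[OF completion_reflect(1) assms, of x] by (simp add: completion_reflect(2))
qed

lemma continuous_dense_L1:
  fixes u :: "'a \<Rightarrow> real"
  assumes "integrable M u" "0 < e"
  shows "\<exists>\<phi>. continuous_on UNIV \<phi> \<and> (\<integral>x. \<bar>u x - \<phi> x\<bar> \<partial>M) < e"
  using assms
proof (induction u arbitrary: e rule: integrable_induct)
  case (base A c)
  have A: "A \<in> sets borel" using base by (simp add: sets_borel)
  \<comment> \<open>The error is supported on \<open>U\<close> minus \<open>F\<close>, of measure
    below 2 d. Adding 1 to \<bar>c\<bar> covers \<open>c = 0\<close> and makes the final estimate
    strict.\<close>
  define d where "d = e / (2 * (\<bar>c\<bar> + 1))"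
  have d: "0 < d" unfolding d_def using base by (intro divide_pos_pos) auto
  obtain F where F: "closed F" "F \<subseteq> A" "measure M A - d < measure M F"
    using exists_closed_subset[OF A d] by blast
  obtain U where U: "open U" "A \<subseteq> U" "measure M U < measure M A + d"
    using exists_open_superset[OF A d] by blast
  obtain \<phi> where \<phi>: "\<phi> \<in> unit_functions" "\<And>x. x \<in> F \<Longrightarrow> \<phi> x = 1" "\<And>x. x \<notin> U \<Longrightarrow> \<phi> x = 0"
    using Urysohn_unit_function[OF F(1) U(1)] F U by blast
  have \<phi>c: "continuous_on UNIV \<phi>" using \<phi>(1) by simp
  have ms: "F \<in> sets M" "U \<in> sets M" using F U by (auto simp: sets_borel)
  have "(\<integral>x. \<bar>indicator A x *\<^sub>R c - c * \<phi> x\<bar> \<partial>M) \<le> (\<integral>x. \<bar>c\<bar> * (indicat_real U x - indicat_real F x) \<partial>M)"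
  proof (rule integral_mono)
    show "integrable M (\<lambda>x. \<bar>indicator A x *\<^sub>R c - c * \<phi> x\<bar>)"
      using base \<phi>c by (intro Bochner_Integration.integrable_abs Bochner_Integration.integrable_diff
          integrable_scaleR_left integrable_real_indicator continuous_integrable continuous_intros) auto
    show "integrable M (\<lambda>x. \<bar>c\<bar> * (indicat_real U x - indicat_real F x))"
      using ms by (intro integrable_mult_right Bochner_Integration.integrable_diff integrable_real_indicator)
        (auto simp: less_top[symmetric])
    fix x
    have "0 \<le> \<phi> x" "\<phi> x \<le> 1" using \<phi>(1) by auto
    then have "\<bar>indicat_real A x - \<phi> x\<bar> \<le> indicat_real U x - indicat_real F x"
      using \<phi>(2,3)[of x] F(2) U(2) by (auto simp: indicator_def abs_le_iff)
    then have "\<bar>c\<bar> * \<bar>indicat_real A x - \<phi> x\<bar> \<le> \<bar>c\<bar> * (indicat_real U x - indicat_real F x)"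
      by (intro mult_left_mono) auto
    then show "\<bar>indicator A x *\<^sub>R c - c * \<phi> x\<bar> \<le> \<bar>c\<bar> * (indicat_real U x - indicat_real F x)"
      by (simp add: abs_mult[symmetric] algebra_simps)
  qed
  also have "\<dots> = \<bar>c\<bar> * (measure M U - measure M F)"
    using ms by (simp add: space_UNIV less_top[symmetric])
  also have "\<dots> \<le> \<bar>c\<bar> * (2 * d)" using F U by (intro mult_left_mono) auto
  also have "\<dots> < (\<bar>c\<bar> + 1) * (2 * d)" using d by simp
  also have "\<dots> = e" by (simp add: d_def field_simps)
  finally show ?case by (intro exI[of _ "\<lambda>x. c * \<phi> x"]) (auto intro: continuous_on_mult \<phi>c)
next
  case (add u v)
  from add.prems have "0 < e / 2" by simp
  obtain \<phi> \<psi> where \<phi>: "continuous_on UNIV \<phi>" "(\<integral>x. \<bar>u x - \<phi> x\<bar> \<partial>M) < e / 2"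
    and \<psi>: "continuous_on UNIV \<psi>" "(\<integral>x. \<bar>v x - \<psi> x\<bar> \<partial>M) < e / 2"
    using add.IH(1)[OF \<open>0 < e / 2\<close>] add.IH(2)[OF \<open>0 < e / 2\<close>] by blast
  note c = continuous_integrable[OF \<phi>(1)] continuous_integrable[OF \<psi>(1)]
  have i: "integrable M (\<lambda>x. \<bar>u x - \<phi> x\<bar>)" "integrable M (\<lambda>x. \<bar>v x - \<psi> x\<bar>)"
    "integrable M (\<lambda>x. \<bar>u x + v x - (\<phi> x + \<psi> x)\<bar>)"
    by (intro Bochner_Integration.integrable_abs Bochner_Integration.integrable_diff
        Bochner_Integration.integrable_add add.hyps c)+
  have "(\<integral>x. \<bar>u x + v x - (\<phi> x + \<psi> x)\<bar> \<partial>M) \<le> (\<integral>x. \<bar>u x - \<phi> x\<bar> + \<bar>v x - \<psi> x\<bar> \<partial>M)"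
    by (intro integral_mono Bochner_Integration.integrable_add i) auto
  also have "\<dots> < e" using i \<phi> \<psi> by simp
  finally show ?case using \<phi> \<psi> by (intro exI[of _ "\<lambda>x. \<phi> x + \<psi> x"]) (auto intro: continuous_on_add)
next
  case (lim u s)
  from lim.prems have "0 < e / 2" by simp
  \<comment> \<open>The simple functions of the induction satisfy \<bar>s i x\<bar> \<le> 2 \<bar>u
    x\<bar>, hence the factor 3 in the majorant.\<close>
  have "(\<lambda>i. \<integral>x. \<bar>u x - s i x\<bar> \<partial>M) \<longlonglongrightarrow> (\<integral>x. 0 \<partial>M)"
  proof (rule integral_dominated_convergence[where w = "\<lambda>x. 3 * \<bar>u x\<bar>"])
    show "AE x in M. (\<lambda>i. \<bar>u x - s i x\<bar>) \<longlonglongrightarrow> 0"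
    proof (rule AE_I2)
      fix x assume "x \<in> space M"
      then have "(\<lambda>i. s i x) \<longlonglongrightarrow> u x" by (rule lim.hyps)
      then have "(\<lambda>i. \<bar>u x - s i x\<bar>) \<longlonglongrightarrow> \<bar>u x - u x\<bar>" by (intro tendsto_intros)
      then show "(\<lambda>i. \<bar>u x - s i x\<bar>) \<longlonglongrightarrow> 0" by simp
    qed
    show "AE x in M. norm \<bar>u x - s i x\<bar> \<le> 3 * \<bar>u x\<bar>" for i
    proof (rule AE_I2)
      fix x assume "x \<in> space M"
      then show "norm \<bar>u x - s i x\<bar> \<le> 3 * \<bar>u x\<bar>" using lim.hyps(3)[of x i] by auto
    qed
  qed (intro borel_measurable_abs borel_measurable_diff borel_measurable_integrable
      borel_measurable_const integrable_mult_right Bochner_Integration.integrable_abs lim.hyps)+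
  then have "\<forall>\<^sub>F i in sequentially. (\<integral>x. \<bar>u x - s i x\<bar> \<partial>M) < e / 2"
    by (rule order_tendstoD(2)) (use \<open>0 < e / 2\<close> in simp)
  then obtain i where i: "(\<integral>x. \<bar>u x - s i x\<bar> \<partial>M) < e / 2"
    using eventually_happens'[OF sequentially_bot] by blast
  obtain \<phi> where \<phi>: "continuous_on UNIV \<phi>" "(\<integral>x. \<bar>s i x - \<phi> x\<bar> \<partial>M) < e / 2"
    using lim.IH[OF \<open>0 < e / 2\<close>] by blast
  have j: "integrable M (\<lambda>x. \<bar>u x - s i x\<bar>)" "integrable M (\<lambda>x. \<bar>s i x - \<phi> x\<bar>)"
    "integrable M (\<lambda>x. \<bar>u x - \<phi> x\<bar>)"
    by (intro Bochner_Integration.integrable_abs Bochner_Integration.integrable_diff lim.hyps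
        continuous_integrable[OF \<phi>(1)])+
  have "(\<integral>x. \<bar>u x - \<phi> x\<bar> \<partial>M) \<le> (\<integral>x. \<bar>u x - s i x\<bar> + \<bar>s i x - \<phi> x\<bar> \<partial>M)"
    by (intro integral_mono Bochner_Integration.integrable_add j) auto
  also have "\<dots> < e" using i j \<phi> by simp
  finally show ?case using \<phi>(1) by blast
qed

end

section \<open>Approximation in L1 with prescribed integral\<close>

context regular_compact_haar
begin

lemma prob_space_completion: "prob_space (completion M)"
  by (rule prob_spaceI) (use emeasure_space_1 in simp)

lemma exists_unit_approximation:
  fixes u :: "'a \<Rightarrow> real"
  assumes u: "u \<in> borel_measurable (completion M)" and u01: "\<And>x. u x \<in> {0..1}" and e: "0 < e"
  obtains \<phi> where "\<phi> \<in> unit_functions" "(\<integral>x. \<phi> x \<partial>M) = (\<integral>x. u x \<partial>completion M)"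
    "(\<integral>x. \<bar>u x - \<phi> x\<bar> \<partial>completion M) < e"
proof -
  obtain u' where u': "u' \<in> borel_measurable M" "AE x in M. u x = u' x"
    using completion_ex_borel_measurable_real[OF u] by blast
  \<comment> \<open>\<open>u'\<close> is a Borel version of \<open>u\<close>, equal to it only
    almost everywhere; clamping restores the range [0, 1] at every point.\<close>
  define v where "v x = max 0 (min 1 (u' x))" for x
  have vm: "v \<in> borel_measurable M" unfolding v_def[abs_def] using u' by measurable
  have uv: "AE x in completion M. u x = v x"
    using AE_completion[OF u'(2)]
  proof eventually_elim
    case (elim x)
    then show ?case using u01[of x] by (simp add: v_def)
  qed
  have v01: "0 \<le> v x" "v x \<le> 1" for x by (auto simp: v_def)
  have vi: "integrable M v" using v01 vm by (intro integrable_const_bound[where B = 1]) auto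
  have vm': "v \<in> borel_measurable (completion M)" using vm by (rule measurable_completion)
  have int_eq: "(\<integral>x. u x \<partial>completion M) = (\<integral>x. v x \<partial>M)"
    using integral_cong_AE[OF u vm' uv] integral_completion[OF vm] by simp
  have "0 < e / 2" using e by simp
  then obtain \<psi>' where \<psi>': "continuous_on UNIV \<psi>'" "(\<integral>x. \<bar>v x - \<psi>' x\<bar> \<partial>M) < e / 2"
    using continuous_dense_L1[OF vi] by blast
  \<comment> \<open>Since \<open>v\<close> takes values in [0, 1], clamping the approximant does not
    increase its distance to \<open>v\<close>.\<close>
  define \<psi> where "\<psi> x = max 0 (min 1 (\<psi>' x))" for x
  have \<psi>c: "continuous_on UNIV \<psi>" unfolding \<psi>_def[abs_def]
    by (intro continuous_intros \<psi>')
  have \<psi>: "\<psi> \<in> unit_functions" using \<psi>c by (auto simp: \<psi>_def)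
  note \<psi>i = continuous_integrable[OF \<psi>c]
  have "(\<integral>x. \<bar>v x - \<psi> x\<bar> \<partial>M) \<le> (\<integral>x. \<bar>v x - \<psi>' x\<bar> \<partial>M)"
  proof (intro integral_mono Bochner_Integration.integrable_abs Bochner_Integration.integrable_diff
      vi \<psi>i continuous_integrable[OF \<psi>'(1)])
    show "\<bar>v x - \<psi> x\<bar> \<le> \<bar>v x - \<psi>' x\<bar>" for x
      using v01[of x] by (auto simp: \<psi>_def max_def min_def)
  qed
  then have v\<psi>: "(\<integral>x. \<bar>v x - \<psi> x\<bar> \<partial>M) < e / 2" using \<psi>' by simp
  define m where "m = (\<integral>x. v x \<partial>M)"
  define m0 where "m0 = (\<integral>x. \<psi> x \<partial>M)"
  have m01: "0 \<le> m" "m \<le> 1"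
    using integral_mono[OF vi, of "\<lambda>_. 1"] v01 by (auto simp: m_def prob_space intro!: integral_nonneg_AE)
  have "m - m0 = (\<integral>x. v x - \<psi> x \<partial>M)" using vi \<psi>i by (simp add: m_def m0_def)
  then have mm: "\<bar>m - m0\<bar> < e / 2"
    using order_le_less_trans[OF integral_abs_bound v\<psi>] by simp
  obtain \<phi> where \<phi>: "\<phi> \<in> unit_functions" "(\<integral>x. \<phi> x \<partial>M) = m" "(\<forall>x. \<phi> x \<le> \<psi> x) \<or> (\<forall>x. \<psi> x \<le> \<phi> x)"
  proof (cases "m \<le> m0")
    case True
    show thesis
      by (rule unit_function_shrink[OF \<psi> m0_def[symmetric] m01(1) True]) (auto intro: that)
  next
    case False
    then have "m0 \<le> m" by simp
    show thesis
      by (rule unit_function_grow[OF \<psi> m0_def[symmetric] \<open>m0 \<le> m\<close> m01(2)]) (auto intro: that)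
  qed
  have \<phi>i: "integrable M \<phi>" using \<phi>(1) by (auto intro: continuous_integrable)
  \<comment> \<open>As \<phi> and \<psi> are comparable, their L1 distance is the difference of
    their integrals, already below e / 2.\<close>
  have "(\<integral>x. \<bar>\<psi> x - \<phi> x\<bar> \<partial>M) = \<bar>m - m0\<bar>"
    using \<phi>(3)
  proof
    assume "\<forall>x. \<phi> x \<le> \<psi> x"
    moreover from this have "m \<le> m0" unfolding m0_def \<phi>(2)[symmetric]
      by (intro integral_mono \<phi>i \<psi>i) auto
    ultimately show ?thesis using \<phi>i \<psi>i by (simp add: m0_def \<phi>(2))
  next
    assume le: "\<forall>x. \<psi> x \<le> \<phi> x"
    have "m0 \<le> m" unfolding m0_def \<phi>(2)[symmetric]
      using le by (intro integral_mono \<phi>i \<psi>i) auto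
    moreover have "\<bar>\<psi> x - \<phi> x\<bar> = \<phi> x - \<psi> x" for x using le by simp
    ultimately show ?thesis using \<phi>i \<psi>i by (simp add: m0_def \<phi>(2))
  qed
  then have "(\<integral>x. \<bar>v x - \<psi> x\<bar> + \<bar>\<psi> x - \<phi> x\<bar> \<partial>M) < e"
    using v\<psi> mm vi \<psi>i \<phi>i by simp
  moreover have "(\<integral>x. \<bar>v x - \<phi> x\<bar> \<partial>M) \<le> (\<integral>x. \<bar>v x - \<psi> x\<bar> + \<bar>\<psi> x - \<phi> x\<bar> \<partial>M)"
    by (intro integral_mono Bochner_Integration.integrable_add Bochner_Integration.integrable_abs
        Bochner_Integration.integrable_diff vi \<psi>i \<phi>i) auto
  ultimately have v\<phi>: "(\<integral>x. \<bar>v x - \<phi> x\<bar> \<partial>M) < e" by simp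
  have \<phi>m: "\<phi> \<in> borel_measurable M" using \<phi>i by auto
  have "(\<integral>x. \<bar>u x - \<phi> x\<bar> \<partial>completion M) = (\<integral>x. \<bar>v x - \<phi> x\<bar> \<partial>completion M)"
    using u vm' measurable_completion[OF \<phi>m] uv by (intro integral_cong_AE) auto
  also have "\<dots> = (\<integral>x. \<bar>v x - \<phi> x\<bar> \<partial>M)"
    using vm \<phi>m by (intro integral_completion) measurable
  finally show thesis using that[OF \<phi>(1)] \<phi>(2) v\<phi> int_eq by (simp add: m_def)
qed

end

locale connected_regular_haar = connected_compact_haar M + regular_compact_haar M
  for M :: "'a::topological_ab_group_add measure"
begin

text \<open>Each of the three functions is replaced at a cost of one L1 error \<open>e\<close>; for
  \<open>f\<close> and \<open>g\<close> the error is uniform in \<open>x\<close>, by reflection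
  invariance. The integrals, and with them the right-hand side, do not change.\<close>

lemma pairing_conv_le:
  fixes f g h :: "'a \<Rightarrow> real"
  defines "\<mu> \<equiv> completion M"
  assumes f: "f \<in> borel_measurable \<mu>" "\<And>x. f x \<in> {0..1}"
    and g: "g \<in> borel_measurable \<mu>" "\<And>x. g x \<in> {0..1}"
    and h: "h \<in> borel_measurable \<mu>" "\<And>x. h x \<in> {0..1}"
    and t: "0 \<le> t"
    and a: "a = (\<integral>x. f x \<partial>\<mu>)" and b: "b = (\<integral>x. g x \<partial>\<mu>)" and c: "c = (\<integral>x. h x \<partial>\<mu>)"
    and tab: "t \<le> a" "t \<le> b" "a + b - t \<le> 1"
  shows "pairing \<mu> (conv \<mu> f g) h \<le> a * b - t * (a + b - t) + t * c"
proof (rule field_le_epsilon)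
  fix \<epsilon> :: real assume eps: "0 < \<epsilon>"
  define e where "e = \<epsilon> / 3"
  have e: "0 < e" using eps by (simp add: e_def)
  interpret \<mu>: prob_space \<mu> unfolding \<mu>_def by (rule prob_space_completion)
  obtain f' where f': "f' \<in> unit_functions" "(\<integral>x. f' x \<partial>M) = a" "(\<integral>x. \<bar>f x - f' x\<bar> \<partial>\<mu>) < e"
    by (rule exists_unit_approximation[OF f[unfolded \<mu>_def] e, folded \<mu>_def]) (rule that, simp_all add: a)
  obtain g' where g': "g' \<in> unit_functions" "(\<integral>x. g' x \<partial>M) = b" "(\<integral>x. \<bar>g x - g' x\<bar> \<partial>\<mu>) < e"
    by (rule exists_unit_approximation[OF g[unfolded \<mu>_def] e, folded \<mu>_def]) (rule that, simp_all add: b)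
  obtain h' where h': "h' \<in> unit_functions" "(\<integral>x. h' x \<partial>M) = c" "(\<integral>x. \<bar>h x - h' x\<bar> \<partial>\<mu>) < e"
    by (rule exists_unit_approximation[OF h[unfolded \<mu>_def] e, folded \<mu>_def]) (rule that, simp_all add: c)
  have cont: "continuous_on UNIV f'" "continuous_on UNIV g'" "continuous_on UNIV h'"
    using f' g' h' by auto
  have m\<mu>: "u \<in> borel_measurable \<mu>" if "continuous_on UNIV u" for u :: "'a \<Rightarrow> real"
    unfolding \<mu>_def by (intro measurable_completion continuous_measurable that)
  have i\<mu>: "integrable \<mu> u" if "continuous_on UNIV u" for u :: "'a \<Rightarrow> real"
    using that unfolding \<mu>_def
    by (subst integrable_completion) (auto intro: continuous_measurable continuous_integrable)
  have I\<mu>: "(\<integral>x. u x \<partial>\<mu>) = (\<integral>x. u x \<partial>M)" if "continuous_on UNIV u" for u :: "'a \<Rightarrow> real"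
    unfolding \<mu>_def by (intro integral_completion continuous_measurable that)
  have b1: "\<bar>p - q\<bar> \<le> 1" if "p \<in> {0..1}" "0 \<le> q \<and> q \<le> 1" for p q :: real using that by auto
  have mf: "(\<lambda>x. \<bar>f x - f' x\<bar>) \<in> borel_measurable \<mu>" and mg: "(\<lambda>x. \<bar>g x - g' x\<bar>) \<in> borel_measurable \<mu>"
    and mh: "(\<lambda>x. \<bar>h x - h' x\<bar>) \<in> borel_measurable \<mu>"
    using f g h cont[THEN m\<mu>] by measurable
  have ig: "integrable \<mu> (\<lambda>x. \<bar>g x - g' x\<bar>)" and ih: "integrable \<mu> (\<lambda>x. \<bar>h x - h' x\<bar>)"
    using mg mh b1 g h g' h' by (auto intro!: \<mu>.integrable_const_bound[where B = 1])
  have conv_le: "conv \<mu> f g x \<le> conv M f' g' x + 2 * e" for x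
  proof -
    have mr: "(\<lambda>y. \<bar>f (x - y) - f' (x - y)\<bar>) \<in> borel_measurable \<mu>"
      and Ir: "(\<integral>y. \<bar>f (x - y) - f' (x - y)\<bar> \<partial>\<mu>) = (\<integral>y. \<bar>f y - f' y\<bar> \<partial>\<mu>)"
      using integral_completion_reflect[OF mf[unfolded \<mu>_def], of x] unfolding \<mu>_def by auto
    have ir: "integrable \<mu> (\<lambda>y. \<bar>f (x - y) - f' (x - y)\<bar>)"
      using mr b1 f f' by (auto intro!: \<mu>.integrable_const_bound[where B = 1])
    have kc: "continuous_on UNIV (\<lambda>y. f' (x - y) * g' y)"
      using continuous_on_convolution_kernel[OF cont(1,2)]
      by (intro continuous_on_mult cont continuous_on_compose2[OF cont(1)] continuous_intros) auto
    have "conv \<mu> f g x \<le> (\<integral>y. f' (x - y) * g' y + \<bar>f (x - y) - f' (x - y)\<bar> + \<bar>g y - g' y\<bar> \<partial>\<mu>)"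
      unfolding conv_def
    proof (rule integral_mono')
      show "integrable \<mu> (\<lambda>y. f' (x - y) * g' y + \<bar>f (x - y) - f' (x - y)\<bar> + \<bar>g y - g' y\<bar>)"
        by (intro Bochner_Integration.integrable_add ir ig i\<mu> kc)
      show "0 \<le> f' (x - y) * g' y + \<bar>f (x - y) - f' (x - y)\<bar> + \<bar>g y - g' y\<bar>" for y
        using f' g' by (auto intro!: add_nonneg_nonneg)
      fix y
      have u: "0 \<le> g y" "g y \<le> 1" "0 \<le> f' (x - y)" "f' (x - y) \<le> 1" using g f' by auto
      have "f (x - y) * g y - f' (x - y) * g' y = (f (x - y) - f' (x - y)) * g y + f' (x - y) * (g y - g' y)"
        by (simp add: algebra_simps)
      moreover have "(f (x - y) - f' (x - y)) * g y \<le> \<bar>f (x - y) - f' (x - y)\<bar>"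
        using u by (intro order_trans[OF mult_right_mono[OF abs_ge_self] mult_left_le]) auto
      moreover have "f' (x - y) * (g y - g' y) \<le> \<bar>g y - g' y\<bar>"
        using u by (intro order_trans[OF mult_left_mono[OF abs_ge_self] mult_left_le_one_le]) auto
      ultimately show "f (x - y) * g y \<le> f' (x - y) * g' y + \<bar>f (x - y) - f' (x - y)\<bar> + \<bar>g y - g' y\<bar>"
        by linarith
    qed
    also have "\<dots> = conv M f' g' x + (\<integral>y. \<bar>f y - f' y\<bar> \<partial>\<mu>) + (\<integral>y. \<bar>g y - g' y\<bar> \<partial>\<mu>)"
      using i\<mu>[OF kc] I\<mu>[OF kc] ir ig Ir by (simp add: conv_def)
    finally show ?thesis using f' g' by simp
  qed
  note cc = continuous_conv[OF cont(1,2)]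
  have ck: "continuous_on UNIV (\<lambda>x. conv M f' g' x * h' x)" by (intro continuous_on_mult cc cont)
  have "pairing \<mu> (conv \<mu> f g) h \<le> (\<integral>x. conv M f' g' x * h' x + \<bar>h x - h' x\<bar> + 2 * e \<partial>\<mu>)"
    unfolding pairing_def
  \<comment> \<open>A non-integrable left-hand side would have integral 0 by convention. A
    nonnegative integrable majorant covers that case too, so measurability of
    \<open>conv \<mu> f g\<close> does not enter.\<close>
  proof (rule integral_mono')
    show "integrable \<mu> (\<lambda>x. conv M f' g' x * h' x + \<bar>h x - h' x\<bar> + 2 * e)"
      by (intro Bochner_Integration.integrable_add ih i\<mu> ck \<mu>.integrable_const)
    fix x
    have cv: "0 \<le> conv M f' g' x" "conv M f' g' x \<le> 1"
      using conv_bounds(1,2)[OF f'(1) g'(1), of x] unit_integral_bounds(2)[OF f'(1)] by auto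
    show "0 \<le> conv M f' g' x * h' x + \<bar>h x - h' x\<bar> + 2 * e"
      using cv h' e by (auto intro!: add_nonneg_nonneg)
    have h01: "0 \<le> h x" "h x \<le> 1" using h by auto
    have "conv \<mu> f g x * h x \<le> (conv M f' g' x + 2 * e) * h x"
      by (intro mult_right_mono conv_le h01)
    moreover have "conv M f' g' x * (h x - h' x) \<le> \<bar>h x - h' x\<bar>"
      using cv by (intro order_trans[OF mult_left_mono[OF abs_ge_self] mult_left_le_one_le]) auto
    moreover have "2 * e * h x \<le> 2 * e" using e h01 by simp
    ultimately show "conv \<mu> f g x * h x \<le> conv M f' g' x * h' x + \<bar>h x - h' x\<bar> + 2 * e"
      by (simp add: algebra_simps)
  qed
  also have "\<dots> = pairing M (conv M f' g') h' + (\<integral>x. \<bar>h x - h' x\<bar> \<partial>\<mu>) + 2 * e"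
    using i\<mu>[OF ck] I\<mu>[OF ck] ih by (simp add: pairing_def \<mu>.prob_space)
  also have "\<dots> \<le> (a * b - t * (a + b - t) + t * c) + \<epsilon>"
    using pairing_conv_continuous_le[OF f'(1) g'(1) h'(1) t f'(2)[symmetric] g'(2)[symmetric] h'(2)[symmetric] tab]
      h'(3) by (simp add: e_def)
  finally show "pairing \<mu> (conv \<mu> f g) h \<le> a * b - t * (a + b - t) + t * c + \<epsilon>" .
qed

end

lemma haar_pairing_conv_le:
  fixes \<mu> :: "'a::topological_ab_group_add measure" and f g h :: "'a \<Rightarrow> real"
  assumes "compact (UNIV :: 'a set)" "connected (UNIV :: 'a set)"
    and haar: "haar_measure \<mu>" and one: "emeasure \<mu> UNIV = 1"
    and fgh: "f \<in> borel_measurable \<mu>" "\<And>x. f x \<in> {0..1}" "g \<in> borel_measurable \<mu>" "\<And>x. g x \<in> {0..1}"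
      "h \<in> borel_measurable \<mu>" "\<And>x. h x \<in> {0..1}"
    and t: "0 \<le> t"
    and abc: "a = (\<integral>x. f x \<partial>\<mu>)" "b = (\<integral>x. g x \<partial>\<mu>)" "c = (\<integral>x. h x \<partial>\<mu>)"
    and tab: "t \<le> a" "t \<le> b" "a + b - t \<le> 1"
  shows "pairing \<mu> (conv \<mu> f g) h \<le> a * b - t * (a + b - t) + t * c"
proof -
  obtain \<nu> where radon: "radon_borel_measure \<nu>"
    and tr: "\<And>a E. E \<in> sets borel \<Longrightarrow> emeasure \<nu> ((+) a ` E) = emeasure \<nu> E"
    and \<mu>: "\<mu> = completion \<nu>"
    using haar unfolding haar_measure_def by blast
  have s: "sets \<nu> = sets borel" and reg:
    "\<And>E. E \<in> sets borel \<Longrightarrow> emeasure \<nu> E = (INF U\<in>{U. open U \<and> E \<subseteq> U}. emeasure \<nu> U)"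
    using radon unfolding radon_borel_measure_def by auto
  have sp: "space \<nu> = UNIV" using sets_eq_imp_space_eq[OF s] by simp
  have "emeasure \<nu> (space \<nu>) = 1" using one unfolding \<mu> sp by (simp add: s)
  then interpret prob_space \<nu> by (rule prob_spaceI)
  interpret connected_regular_haar \<nu>
    by unfold_locales (use assms(1,2) s tr reg in auto)
  show ?thesis unfolding \<mu> by (rule pairing_conv_le[OF fgh[unfolded \<mu>] t abc[unfolded \<mu>] tab])
qed

section \<open>Centered intervals on the circle\<close>

lemma to_circle_diff: "to_circle u - to_circle v = to_circle (u - v)"
  by transfer (simp add: int_cong_def)

lemma to_circle_add_int: "to_circle (x + of_int k) = to_circle x"
  by (simp add: to_circle_eq_iff)

lemma to_circle_surj: obtains u where "z = to_circle u"
  using to_circle_image by blast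

section \<open>Integration over the circle by periods on the real line\<close>

lemma circle_measure_eq_distr: "circle_measure = distr (lebesgue_on {0..<1}) circle_measure to_circle"
  unfolding circle_measure_def by (rule embed_measure_eq_distr') (simp add: inj_on_to_circle)

lemma measurable_circle:
  fixes F :: "circle \<Rightarrow> real"
  assumes "(\<lambda>x. F (to_circle x)) \<in> borel_measurable borel"
  shows "F \<in> borel_measurable circle_measure"
  unfolding circle_measure_def using assms
  by (intro measurable_embed_measure1 measurable_restrict_space1 measurable_completion) simp

lemma prob_space_circle: "prob_space circle_measure"
  by (rule prob_spaceI) (simp add: space_circle_measure emeasure_circle_measure_UNIV)

lemma integrable_circle:
  fixes F :: "circle \<Rightarrow> real"
  assumes "(\<lambda>x. F (to_circle x)) \<in> borel_measurable borel" "\<And>z. \<bar>F z\<bar> \<le> K"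
  shows "integrable circle_measure F"
proof -
  interpret prob_space circle_measure by (rule prob_space_circle)
  show ?thesis by (rule integrable_const_bound[where B = K]) (auto intro: assms measurable_circle)
qed

lemma integrable_indicator_times:
  fixes p :: "real \<Rightarrow> real"
  assumes S: "S \<in> sets borel" "bounded S"
    and p: "p \<in> borel_measurable borel" "\<And>x. x \<in> S \<Longrightarrow> \<bar>p x\<bar> \<le> K"
  shows "integrable lborel (\<lambda>x. indicat_real S x * p x)"
proof (rule Bochner_Integration.integrable_bound)
  show "integrable lborel (\<lambda>x. indicat_real S x * K)"
    using S emeasure_bounded_finite by (intro integrable_mult_left integrable_real_indicator) auto
  show "(\<lambda>x. indicat_real S x * p x) \<in> borel_measurable lborel" using S p by simp
  show "AE x in lborel. norm (indicat_real S x * p x) \<le> norm (indicat_real S x * K)"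
    using p(2) by (intro AE_I2) (force simp: indicator_def)
qed

lemma integral_circle:
  fixes F :: "circle \<Rightarrow> real"
  assumes F: "(\<lambda>x. F (to_circle x)) \<in> borel_measurable borel"
  shows "(\<integral>z. F z \<partial>circle_measure) = (\<integral>x. indicat_real {0..<1} x * F (to_circle x) \<partial>lborel)"
proof -
  have m: "to_circle \<in> measurable (lebesgue_on {0..<1}) circle_measure"
    unfolding circle_measure_def by (rule measurable_embed_measure2') (simp add: inj_on_to_circle)
  have "(\<integral>z. F z \<partial>circle_measure) = (\<integral>x. F (to_circle x) \<partial>lebesgue_on {0..<1})"
    by (subst circle_measure_eq_distr) (rule integral_distr[OF m measurable_circle[OF F]])
  also have "\<dots> = (\<integral>x. indicat_real {0..<1} x * F (to_circle x) \<partial>lebesgue)"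
    by (subst integral_restrict_space) auto
  also have "\<dots> = (\<integral>x. indicat_real {0..<1} x * F (to_circle x) \<partial>lborel)"
    using F by (intro integral_completion) simp
  finally show ?thesis .
qed

text \<open>Moving the period to \<open>s = -1/2\<close> represents short centered arcs by real
  intervals without wrapping.\<close>

lemma integral_circle_shift:
  fixes F :: "circle \<Rightarrow> real"
  assumes F: "(\<lambda>x. F (to_circle x)) \<in> borel_measurable borel" and bd: "\<And>z. \<bar>F z\<bar> \<le> K"
  shows "(\<integral>z. F z \<partial>circle_measure) = (\<integral>x. indicat_real {s..<s + 1} x * F (to_circle x) \<partial>lborel)"
proof -
  define p where "p x = F (to_circle x)" for x
  have p: "p \<in> borel_measurable borel" "\<And>x. \<bar>p x\<bar> \<le> K" using F bd by (simp_all add: p_def[abs_def])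
  have per: "p (x + of_int k) = p x" for x k unfolding p_def by (simp add: to_circle_add_int)
  have sh: "(\<integral>x. indicat_real S x * p x \<partial>lborel) = (\<integral>x. indicat_real S (x + of_int k) * p x \<partial>lborel)" for S k
    using lborel_integral_real_affine[of 1 "\<lambda>x. indicat_real S x * p x" "of_int k"] per
    by (simp add: add.commute)
  have i: "integrable lborel (\<lambda>x. indicat_real {a..<b} x * p x)" for a b
    by (rule integrable_indicator_times[where K = K]) (auto simp: p)
  \<comment> \<open>After an integer shift the period is [r, 1 + r); its part beyond 1 is moved back
    to [0, r).\<close>
  define r where "r = frac s"
  have r: "0 \<le> r" "r < 1" "s = r + of_int \<lfloor>s\<rfloor>" by (auto simp: r_def frac_lt_1) (simp add: frac_def)
  have "(\<integral>x. indicat_real {s..<s + 1} x * p x \<partial>lborel)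
      = (\<integral>x. indicat_real {s..<s + 1} (x + of_int \<lfloor>s\<rfloor>) * p x \<partial>lborel)" by (rule sh)
  also have "\<dots> = (\<integral>x. indicat_real {r..<1} x * p x + indicat_real {1..<1 + r} x * p x \<partial>lborel)"
    using r by (intro Bochner_Integration.integral_cong) (auto simp: indicator_def)
  also have "\<dots> = (\<integral>x. indicat_real {r..<1} x * p x \<partial>lborel) + (\<integral>x. indicat_real {1..<1 + r} x * p x \<partial>lborel)"
    by (rule Bochner_Integration.integral_add[OF i i])
  also have "(\<integral>x. indicat_real {1..<1 + r} x * p x \<partial>lborel)
      = (\<integral>x. indicat_real {1..<1 + r} (x + of_int 1) * p x \<partial>lborel)" by (rule sh)
  also have "\<dots> = (\<integral>x. indicat_real {0..<r} x * p x \<partial>lborel)"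
    by (intro Bochner_Integration.integral_cong) (auto simp: indicator_def)
  also have "(\<integral>x. indicat_real {r..<1} x * p x \<partial>lborel) + \<dots>
      = (\<integral>x. indicat_real {r..<1} x * p x + indicat_real {0..<r} x * p x \<partial>lborel)"
    by (rule Bochner_Integration.integral_add[OF i i, symmetric])
  also have "\<dots> = (\<integral>x. indicat_real {0..<1} x * p x \<partial>lborel)"
    using r by (intro Bochner_Integration.integral_cong) (auto simp: indicator_def)
  finally show ?thesis using integral_circle[OF F] by (simp add: p_def)
qed

lemma integral_circle_reflect:
  fixes F :: "circle \<Rightarrow> real"
  assumes F: "(\<lambda>x. F (to_circle x)) \<in> borel_measurable borel" and bd: "\<And>z. \<bar>F z\<bar> \<le> K"
  shows "(\<integral>z. F (w - z) \<partial>circle_measure) = (\<integral>z. F z \<partial>circle_measure)"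
proof -
  obtain u where w: "w = to_circle u" by (rule to_circle_surj)
  have m: "(\<lambda>x. F (w - to_circle x)) \<in> borel_measurable borel"
    using measurable_compose[OF _ F, of "\<lambda>x. u - x" borel] by (simp add: w to_circle_diff)
  have "(\<integral>z. F (w - z) \<partial>circle_measure) = (\<integral>x. indicat_real {0..<1} x * F (to_circle (u - x)) \<partial>lborel)"
    using integral_circle[OF m] by (simp add: w to_circle_diff)
  also have "\<dots> = (\<integral>x. indicat_real {0..<1} (u - x) * F (to_circle x) \<partial>lborel)"
    using lborel_integral_real_affine[of "-1" "\<lambda>x. indicat_real {0..<1} (u - x) * F (to_circle x)" u] by simp
  \<comment> \<open>Reflection turns [0, 1) into (u - 1, u], which differs from a half-open period
    only at two points.\<close>
  also have "\<dots> = (\<integral>x. indicat_real {u - 1..<u - 1 + 1} x * F (to_circle x) \<partial>lborel)"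
  proof (rule integral_cong_AE)
    show "AE x in lborel. indicat_real {0..<1} (u - x) * F (to_circle x)
        = indicat_real {u - 1..<u - 1 + 1} x * F (to_circle x)"
      using AE_lborel_singleton[of u] AE_lborel_singleton[of "u - 1"]
      by eventually_elim (auto simp: indicator_def)
  qed (use F in measurable)
  also have "\<dots> = (\<integral>z. F z \<partial>circle_measure)" by (rule integral_circle_shift[OF F bd, symmetric])
  finally show ?thesis .
qed

section \<open>Centered arcs and their real representatives\<close>

lemma centered_interval_borel:
  assumes "centered_interval A"
  shows "to_circle -` A \<in> sets borel"
proof -
  obtain r I where I: "{-r<..<r} \<subseteq> I" "I \<subseteq> {-r..r}" "A = to_circle ` I"
    using assms unfolding centered_interval_def by blast
  have "I - {-r<..<r} \<subseteq> {-r, r}" using I(2) by auto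
  then have "finite (I - {-r<..<r})" by (rule finite_subset) simp
  then have "{-r<..<r} \<union> (I - {-r<..<r}) \<in> sets borel"
    by (intro sets.Un borel_open borel_closed[OF finite_imp_closed] open_greaterThanLessThan)
  moreover have "{-r<..<r} \<union> (I - {-r<..<r}) = I" using I(1) by auto
  ultimately have Ib: "I \<in> sets borel" by simp
  have "to_circle -` A = (\<Union>k::int. (\<lambda>x. x - of_int k) -` I)"
    unfolding I(3) by (auto simp: to_circle_eq_iff image_iff Ints_def) (metis add_diff_cancel_left' diff_add_cancel)+
  moreover have "(\<lambda>x. x - of_int k) -` I \<in> sets borel" for k :: int
    using measurable_sets[of "\<lambda>x::real. x - of_int k" borel borel I] Ib by simp
  ultimately show ?thesis by auto
qed

lemma indicator_circle_borel:
  assumes "centered_interval A"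
  shows "(\<lambda>x. indicat_real A (to_circle x)) \<in> borel_measurable borel"
proof -
  have "(\<lambda>x. indicat_real A (to_circle x)) = indicat_real (to_circle -` A)"
    by (auto simp: indicator_def)
  then show ?thesis using centered_interval_borel[OF assms] by simp
qed

lemma measure_circle_eq_integral:
  "measure circle_measure A = (\<integral>z. indicat_real A z \<partial>circle_measure)"
  by (simp add: space_circle_measure)

text \<open>The radius \<open>r\<close> satisfies a \<le> 2 r: for r \<ge> 1/2 because a \<le> 1,
  otherwise because the representatives of \<open>A\<close> in one period lie in [-r, r]. An
  inclusion remains correct when the interval wraps around the circle.\<close>

lemma centered_interval_contains:
  assumes A: "centered_interval A" and a: "a = measure circle_measure A" and x: "\<bar>x\<bar> < a / 2"
  shows "to_circle x \<in> A"
proof -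
  obtain r I where I: "{-r<..<r} \<subseteq> I" "I \<subseteq> {-r..r}" "A = to_circle ` I"
    using A unfolding centered_interval_def by blast
  interpret prob_space circle_measure by (rule prob_space_circle)
  have a1: "a \<le> 1" unfolding a by (rule prob_le_1)
  have "a \<le> 2 * r" if r: "r < 1 / 2"
  proof (cases "r < 0")
    \<comment> \<open>Here \<open>A\<close> is empty and a = 0, which the assumption on
      \<open>x\<close> excludes.\<close>
    case True
    then have "A = {}" using I by auto
    then show ?thesis using a x by simp
  next
    case False
    note m = indicator_circle_borel[OF A]
    have "a = (\<integral>x. indicat_real {-1/2..<-1/2 + 1} x * indicat_real A (to_circle x) \<partial>lborel)"
      unfolding a measure_circle_eq_integral by (rule integral_circle_shift[OF m, where K = 1]) (auto simp: indicator_def)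
    also have "\<dots> \<le> (\<integral>x. indicat_real {-r..r} x \<partial>lborel)"
    proof (rule integral_mono)
      show "integrable lborel (\<lambda>x. indicat_real {-1/2..<-1/2 + 1} x * indicat_real A (to_circle x))"
        by (intro integrable_indicator_times[where K = 1] m) (auto simp: indicator_def)
      show "indicat_real {-1/2..<-1/2 + 1} x * indicat_real A (to_circle x) \<le> indicat_real {-r..r} x" for x
      proof (cases "x \<in> {-1/2..<1/2} \<and> to_circle x \<in> A")
        case True
        then obtain i where i: "i \<in> I" "x - i \<in> \<int>"
          unfolding I(3) by (metis imageE to_circle_eq_iff)
        then obtain k where ik: "i \<in> I" "x - i = of_int k" by (metis Ints_cases)
        have "-r \<le> i" "i \<le> r" "-1/2 \<le> x" "x < 1/2" using True ik(1) I(2) by auto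
        \<comment> \<open>Both points are at distance at most 1/2 from 0, one of them strictly
          less.\<close>
        then have "\<bar>of_int k :: real\<bar> < 1" using r unfolding ik(2)[symmetric] by linarith
        then have "k = 0" by linarith
        then show ?thesis using ik I(2) by (auto simp: indicator_def)
      qed (auto simp: indicator_def)
    qed (use False in auto)
    also have "\<dots> = 2 * r" using False by simp
    finally show ?thesis .
  qed
  with x a1 have "x \<in> {-r<..<r}" by (cases "r < 1 / 2") auto
  then show ?thesis using I by auto
qed

text \<open>The graph is a trapezoid with plateau of height \<open>K\<close> over [-d, d] and flanks
  of slope 1 and -1, each of width \<open>K\<close>.\<close>

lemma has_integral_trapezoid:
  fixes d K :: real
  assumes "0 \<le> d" "0 \<le> K"
  shows "((\<lambda>u. min K (d + K - \<bar>u\<bar>)) has_integral K * (2 * d + K)) {-(d + K)..d + K}"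
proof -
  let ?f = "\<lambda>u. min K (d + K - \<bar>u\<bar>)"
  have "((\<lambda>u. u + (d + K)) has_integral ((-d + (d + K))\<^sup>2 / 2 - (-(d + K) + (d + K))\<^sup>2 / 2)) {-(d + K)..-d}"
    using assms by (intro fundamental_theorem_of_calculus)
      (auto intro!: derivative_eq_intros simp flip: has_real_derivative_iff_has_vector_derivative)
  then have 1: "(?f has_integral K\<^sup>2 / 2) {-(d + K)..-d}"
    using assms by (subst has_integral_cong[where g = "\<lambda>u. u + (d + K)"]) (auto simp: min_def)
  have "((\<lambda>u. K) has_integral (d - (- d)) *\<^sub>R K) {-d..d}"
    using assms has_integral_const_real[of K "-d" d] by simp
  then have 2: "(?f has_integral 2 * d * K) {-d..d}"
    by (subst has_integral_cong[where g = "\<lambda>u. K"]) (auto simp: min_def)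
  have "((\<lambda>u. d + K - u) has_integral (- (d + K - (d + K))\<^sup>2 / 2 - - (d + K - d)\<^sup>2 / 2)) {d..d + K}"
    using assms by (intro fundamental_theorem_of_calculus)
      (auto intro!: derivative_eq_intros simp: field_simps simp flip: has_real_derivative_iff_has_vector_derivative)
  then have 3: "(?f has_integral K\<^sup>2 / 2) {d..d + K}"
    using assms by (subst has_integral_cong[where g = "\<lambda>u. d + K - u"]) (auto simp: min_def)
  have "(?f has_integral K\<^sup>2 / 2 + 2 * d * K) {-(d + K)..d}"
    using assms by (intro has_integral_combine[OF _ _ 1 2]) auto
  then have "(?f has_integral K\<^sup>2 / 2 + 2 * d * K + K\<^sup>2 / 2) {-(d + K)..d + K}"
    using assms by (intro has_integral_combine[OF _ _ _ 3]) auto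
  then show ?thesis by (simp add: algebra_simps power2_eq_square)
qed

lemma lborel_integral_trapezoid:
  fixes d K :: real
  assumes "0 \<le> d" "0 \<le> K"
  shows "integrable lborel (\<lambda>u. indicat_real {-(d + K)..d + K} u * min K (d + K - \<bar>u\<bar>))"
    and "(\<integral>u. indicat_real {-(d + K)..d + K} u * min K (d + K - \<bar>u\<bar>) \<partial>lborel) = K * (2 * d + K)"
proof -
  have c: "continuous_on {-(d + K)..d + K} (\<lambda>u. min K (d + K - \<bar>u\<bar>))" by (intro continuous_intros)
  have s: "set_integrable lborel {-(d + K)..d + K} (\<lambda>u. min K (d + K - \<bar>u\<bar>))"
    unfolding set_integrable_def by (intro borel_integrable_compact c) simp
  then show "integrable lborel (\<lambda>u. indicat_real {-(d + K)..d + K} u * min K (d + K - \<bar>u\<bar>))"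
    by (simp add: set_integrable_def)
  show "(\<integral>u. indicat_real {-(d + K)..d + K} u * min K (d + K - \<bar>u\<bar>) \<partial>lborel) = K * (2 * d + K)"
    using set_borel_integral_eq_integral(2)[OF s] integral_unique[OF has_integral_trapezoid[OF assms]]
    by (simp add: set_lebesgue_integral_def)
qed

section \<open>Lower bounds for the convolution of two arcs\<close>

locale centered_intervals =
  fixes A B C :: "circle set" and a b c :: real
  assumes A: "centered_interval A" and B: "centered_interval B" and C: "centered_interval C"
    and a: "a = measure circle_measure A" and b: "b = measure circle_measure B"
    and c: "c = measure circle_measure C"
begin

text \<open>The convolution lifted to a periodic function on the line. It is bounded below by 0, by
  a trapezoid and by a + b - 1.\<close>

definition overlap :: "real \<Rightarrow> real" where
  "overlap u = conv circle_measure (indicat_real A) (indicat_real B) (to_circle u)"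

lemma measure_bounds: "0 \<le> a" "a \<le> 1" "0 \<le> b" "b \<le> 1" "0 \<le> c" "c \<le> 1"
proof -
  interpret prob_space circle_measure by (rule prob_space_circle)
  show "0 \<le> a" "a \<le> 1" "0 \<le> b" "b \<le> 1" "0 \<le> c" "c \<le> 1"
    unfolding a b c by (simp_all add: prob_le_1)
qed

lemma kernel_borel:
  "(\<lambda>v. indicat_real A (to_circle u - to_circle v) * indicat_real B (to_circle v)) \<in> borel_measurable borel"
proof -
  have "(\<lambda>v. indicat_real A (to_circle (u - v))) \<in> borel_measurable borel"
    using measurable_compose[OF _ indicator_circle_borel[OF A], of "\<lambda>v. u - v" borel] by simp
  then show ?thesis using indicator_circle_borel[OF B] by (simp add: to_circle_diff)
qed

lemma overlap_eq:
  "overlap u = (\<integral>v. indicat_real {-1/2..<-1/2 + 1} v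
      * (indicat_real A (to_circle (u - v)) * indicat_real B (to_circle v)) \<partial>lborel)"
  unfolding overlap_def conv_def
  by (subst integral_circle_shift[OF kernel_borel, where K = 1 and s = "-1/2"])
     (auto simp: indicator_def to_circle_diff)

lemma overlap_borel: "overlap \<in> borel_measurable borel"
proof -
  let ?N = "borel \<Otimes>\<^sub>M lborel :: (real \<times> real) measure"
  have "(\<lambda>p. indicat_real {-1/2..<-1/2 + 1} (snd p)) \<in> borel_measurable ?N" by measurable
  moreover have "(\<lambda>p. indicat_real A (to_circle (fst p - snd p))) \<in> borel_measurable ?N"
    by (rule measurable_compose[OF _ indicator_circle_borel[OF A]]) measurable
  moreover have "(\<lambda>p. indicat_real B (to_circle (snd p))) \<in> borel_measurable ?N"
    by (rule measurable_compose[OF _ indicator_circle_borel[OF B]]) measurable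
  ultimately have "(\<lambda>(u, v). indicat_real {-1/2..<-1/2 + 1} v
      * (indicat_real A (to_circle (u - v)) * indicat_real B (to_circle v))) \<in> borel_measurable ?N"
    unfolding case_prod_unfold by (intro borel_measurable_times)
  then show ?thesis unfolding overlap_eq[abs_def] by (rule lborel.borel_measurable_lebesgue_integral)
qed

lemma kernel_integrable:
  "integrable circle_measure (\<lambda>z. indicat_real A (to_circle u - z) * indicat_real B z)"
  by (rule integrable_circle[OF kernel_borel, where K = 1]) (auto simp: indicator_def)

lemma overlap_nonneg: "0 \<le> overlap u"
  unfolding overlap_def conv_def by (intro integral_nonneg_AE) auto

lemma overlap_le_one: "overlap u \<le> 1"
proof -
  interpret prob_space circle_measure by (rule prob_space_circle)
  have "overlap u \<le> (\<integral>z. 1 \<partial>circle_measure)"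
    unfolding overlap_def conv_def
    by (intro integral_mono kernel_integrable) (auto simp: indicator_def)
  then show ?thesis by (simp add: prob_space)
qed

text \<open>When a + b > 1, the arcs can meet on both sides of the circle, and the trapezoid counts
  just one of the two pieces. This bound restores the forced overlap.\<close>

lemma overlap_ge_excess: "a + b - 1 \<le> overlap u"
proof -
  interpret prob_space circle_measure by (rule prob_space_circle)
  have mA: "(\<lambda>v. indicat_real A (to_circle u - to_circle v)) \<in> borel_measurable borel"
    using measurable_compose[OF _ indicator_circle_borel[OF A], of "\<lambda>v. u - v" borel]
    by (simp add: to_circle_diff)
  have iA: "integrable circle_measure (\<lambda>z. indicat_real A (to_circle u - z))"
    by (rule integrable_circle[OF mA, where K = 1]) (auto simp: indicator_def)
  have iB: "integrable circle_measure (indicat_real B)"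
    by (rule integrable_circle[OF indicator_circle_borel[OF B], where K = 1]) (auto simp: indicator_def)
  have "(\<integral>z. indicat_real A (to_circle u - z) \<partial>circle_measure) = a"
    unfolding a measure_circle_eq_integral
    by (rule integral_circle_reflect[OF indicator_circle_borel[OF A], where K = 1]) (auto simp: indicator_def)
  then have "a + b - 1 = (\<integral>z. indicat_real A (to_circle u - z) + indicat_real B z - 1 \<partial>circle_measure)"
    using iA iB prob_space by (simp add: b space_circle_measure)
  also have "\<dots> \<le> overlap u" unfolding overlap_def conv_def
  proof (rule integral_mono[OF _ kernel_integrable])
    show "integrable circle_measure (\<lambda>z. indicat_real A (to_circle u - z) + indicat_real B z - 1)"
      using iA iB by simp
  qed (auto simp: indicator_def)
  finally show ?thesis .
qed

lemma overlap_ge_trapezoid: "min (min a b) ((a + b) / 2 - \<bar>u\<bar>) \<le> overlap u"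
proof -
  \<comment> \<open>(l, r) is the intersection of (-b/2, b/2) with (u - a/2, u + a/2); r - l is
    negative when these intervals are apart.\<close>
  define l where "l = max (-b/2) (u - a/2)"
  define r where "r = min (b/2) (u + a/2)"
  have lr: "r - l = min (min a b) ((a + b) / 2 - \<bar>u\<bar>)"
    by (auto simp: l_def r_def min_def max_def abs_if field_simps)
  show ?thesis
  proof (cases "l \<le> r")
    case False
    then show ?thesis using lr overlap_nonneg[of u] by linarith
  next
    case True
    have "r - l = (\<integral>v. indicat_real {l<..<r} v \<partial>lborel)" using True by simp
    also have "\<dots> \<le> overlap u" unfolding overlap_eq
    proof (rule integral_mono)
      show "integrable lborel (\<lambda>v. indicat_real {-1/2..<-1/2 + 1} v
          * (indicat_real A (to_circle (u - v)) * indicat_real B (to_circle v)))"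
        using kernel_borel[of u] by (intro integrable_indicator_times[where K = 1])
          (auto simp: to_circle_diff indicator_def)
      show "indicat_real {l<..<r} v \<le> indicat_real {-1/2..<-1/2 + 1} v
          * (indicat_real A (to_circle (u - v)) * indicat_real B (to_circle v))" for v
      proof (cases "v \<in> {l<..<r}")
        case v: True
        then have "-b/2 < v" "v < b/2" "u - a/2 < v" "v < u + a/2" by (simp_all add: l_def r_def)
        then have "\<bar>v\<bar> < b / 2" "\<bar>u - v\<bar> < a / 2" unfolding abs_less_iff by linarith+
        then have "to_circle v \<in> B" "to_circle (u - v) \<in> A" "v \<in> {-1/2..<-1/2 + 1}"
          using centered_interval_contains[OF B b] centered_interval_contains[OF A a] measure_bounds(4)
          by (auto simp: abs_less_iff)
        then show ?thesis by simp
      qed simp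
    qed (use True in auto)
    finally show ?thesis using lr by simp
  qed
qed

lemma pairing_ge_integral_overlap:
  "(\<integral>u. indicat_real {-c/2<..<c/2} u * overlap u \<partial>lborel)
    \<le> pairing circle_measure (conv circle_measure (indicat_real A) (indicat_real B)) (indicat_real C)"
proof -
  define p where "p u = overlap u * indicat_real C (to_circle u)" for u
  have p: "p \<in> borel_measurable borel" unfolding p_def[abs_def]
    using overlap_borel indicator_circle_borel[OF C] by (rule borel_measurable_times)
  have p1: "\<bar>p u\<bar> \<le> 1" for u
    using overlap_nonneg[of u] overlap_le_one[of u] by (auto simp: p_def indicator_def)
  have "pairing circle_measure (conv circle_measure (indicat_real A) (indicat_real B)) (indicat_real C)
      = (\<integral>u. indicat_real {-1/2..<-1/2 + 1} u * p u \<partial>lborel)"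
    unfolding pairing_def p_def overlap_def
  proof (rule integral_circle_shift[where K = 1])
    show "(\<lambda>x. conv circle_measure (indicat_real A) (indicat_real B) (to_circle x) * indicat_real C (to_circle x))
        \<in> borel_measurable borel" using p unfolding p_def[abs_def] overlap_def .
    fix z obtain u where "z = to_circle u" by (rule to_circle_surj)
    then show "\<bar>conv circle_measure (indicat_real A) (indicat_real B) z * indicat_real C z\<bar> \<le> 1"
      using p1[of u] by (simp add: p_def overlap_def)
  qed
  moreover have "(\<integral>u. indicat_real {-c/2<..<c/2} u * overlap u \<partial>lborel)
      \<le> (\<integral>u. indicat_real {-1/2..<-1/2 + 1} u * p u \<partial>lborel)"
  proof (rule integral_mono)
    show "integrable lborel (\<lambda>u. indicat_real {-1/2..<-1/2 + 1} u * p u)"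
      by (rule integrable_indicator_times[where K = 1]) (auto simp: p p1)
    show "integrable lborel (\<lambda>u. indicat_real {-c/2<..<c/2} u * overlap u)"
      using overlap_nonneg overlap_le_one measure_bounds
      by (intro integrable_indicator_times[where K = 1]) (auto simp: overlap_borel)
    show "indicat_real {-c/2<..<c/2} u * overlap u \<le> indicat_real {-1/2..<-1/2 + 1} u * p u" for u
    proof (cases "u \<in> {-c/2<..<c/2}")
      case True
      then have "\<bar>u\<bar> < c / 2" by auto
      then have "to_circle u \<in> C" by (rule centered_interval_contains[OF C c])
      moreover have "u \<in> {-1/2..<-1/2 + 1}" using True measure_bounds(6) by auto
      ultimately show ?thesis using True by (simp add: p_def)
    qed (use overlap_nonneg in \<open>auto simp: p_def indicator_def\<close>)
  qed
  ultimately show ?thesis by simp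
qed

text \<open>The arc of length c lies under the plateau of the trapezoid. The left-hand side is the
  upper bound at \<open>t = min a b\<close>.\<close>

lemma pairing_ge_low:
  assumes "c \<le> \<bar>a - b\<bar>"
  shows "min a b * c
    \<le> pairing circle_measure (conv circle_measure (indicat_real A) (indicat_real B)) (indicat_real C)"
proof -
  have "min a b * c = (\<integral>u. indicat_real {-c/2<..<c/2} u * min a b \<partial>lborel)"
    using measure_bounds by simp
  also have "\<dots> \<le> (\<integral>u. indicat_real {-c/2<..<c/2} u * overlap u \<partial>lborel)"
  proof (rule integral_mono)
    show "integrable lborel (\<lambda>u. indicat_real {-c/2<..<c/2} u * min a b)"
      using measure_bounds by simp
    show "integrable lborel (\<lambda>u. indicat_real {-c/2<..<c/2} u * overlap u)"
      using overlap_nonneg overlap_le_one measure_bounds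
      by (intro integrable_indicator_times[where K = 1]) (auto simp: overlap_borel)
    show "indicat_real {-c/2<..<c/2} u * min a b \<le> indicat_real {-c/2<..<c/2} u * overlap u" for u
    proof (cases "u \<in> {-c/2<..<c/2}")
      case True
      then have "min a b \<le> (a + b) / 2 - \<bar>u\<bar>" using assms by (auto simp: min_def abs_if field_simps split: if_splits)
      then have "min a b \<le> overlap u" using overlap_ge_trapezoid[of u] by simp
      then show ?thesis using True by simp
    qed simp
  qed
  also note pairing_ge_integral_overlap
  finally show ?thesis .
qed

text \<open>The integral is split at height \<open>t\<close>: a rectangle of area t c below, and
  above it the tip of the trapezoid, of area (a - t) (b - t). The condition a + b - 2 t \<le> c says
  that the base of the tip fits over the arc of \<open>C\<close>.\<close>

lemma pairing_ge_high:
  assumes t: "0 \<le> t" "t \<le> a" "t \<le> b" "a + b - 2 * t \<le> c"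
    and cases: "t = 0 \<or> t = a + b - 1 \<or> a + b - 2 * t = c"
  shows "a * b - t * (a + b - t) + t * c
    \<le> pairing circle_measure (conv circle_measure (indicat_real A) (indicat_real B)) (indicat_real C)"
proof -
  \<comment> \<open>\<open>K\<close> is the height of the trapezoid above level \<open>t\<close>,
    \<open>d\<close> half the length of its plateau; d + K is half the base at level
    \<open>t\<close>.\<close>
  define K where "K = min a b - t"
  define d where "d = (a + b) / 2 - min a b"
  have Kd: "0 \<le> d" "0 \<le> K" using t by (auto simp: K_def d_def min_def)
  have dK: "d + K = (a + b) / 2 - t" by (simp add: K_def d_def)
  note trap = lborel_integral_trapezoid[OF Kd]
  have "2 * d + K = max a b - t" by (auto simp: d_def K_def min_def max_def field_simps)
  then have "K * (2 * d + K) = a * b - t * (a + b - t)"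
    by (auto simp: K_def min_def max_def algebra_simps)
  then have "a * b - t * (a + b - t) + t * c = (\<integral>u. indicat_real {-c/2<..<c/2} u * t
      + indicat_real {-(d + K)..d + K} u * min K (d + K - \<bar>u\<bar>) \<partial>lborel)"
    using trap measure_bounds by (subst Bochner_Integration.integral_add) auto
  also have "\<dots> \<le> (\<integral>u. indicat_real {-c/2<..<c/2} u * overlap u \<partial>lborel)"
  proof (rule integral_mono)
    show "integrable lborel (\<lambda>u. indicat_real {-c/2<..<c/2} u * t
      + indicat_real {-(d + K)..d + K} u * min K (d + K - \<bar>u\<bar>))"
      using measure_bounds by (intro Bochner_Integration.integrable_add trap) auto
    show "integrable lborel (\<lambda>u. indicat_real {-c/2<..<c/2} u * overlap u)"
      using overlap_nonneg overlap_le_one measure_bounds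
      by (intro integrable_indicator_times[where K = 1]) (auto simp: overlap_borel)
    fix u
    show "indicat_real {-c/2<..<c/2} u * t + indicat_real {-(d + K)..d + K} u * min K (d + K - \<bar>u\<bar>)
        \<le> indicat_real {-c/2<..<c/2} u * overlap u"
    proof (cases "\<bar>u\<bar> < d + K")
      case True
      have "d + K \<le> c / 2" using t(4) unfolding dK by (simp add: field_simps)
      then have "-c/2 < u" "u < c/2" using True by (auto simp: abs_less_iff)
      then have u: "u \<in> {-c/2<..<c/2}" "u \<in> {-(d + K)..d + K}" using True by auto
      have "t + min K (d + K - \<bar>u\<bar>) = min (min a b) ((a + b) / 2 - \<bar>u\<bar>)"
        by (simp add: dK) (simp add: K_def)
      then show ?thesis using u overlap_ge_trapezoid[of u] by simp
    next
      case False
      then have "indicat_real {-(d + K)..d + K} u * min K (d + K - \<bar>u\<bar>) \<le> 0"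
        by (auto simp: indicator_def)
      \<comment> \<open>Away from the tip the rectangle alone must fit under \<open>overlap\<close>.
        This holds by nonnegativity, by the forced overlap, or because the base already fills the
        whole arc.\<close>
      moreover have "t \<le> overlap u" if "u \<in> {-c/2<..<c/2}"
        using cases
      proof (elim disjE)
        assume "a + b - 2 * t = c"
        then have "d + K = c / 2" unfolding dK by (simp add: field_simps)
        moreover have "\<bar>u\<bar> < c / 2" using that by (auto simp: abs_if)
        ultimately show ?thesis using False by simp
      qed (use overlap_nonneg overlap_ge_excess in auto)
      ultimately show ?thesis by (auto simp: indicator_def)
    qed
  qed
  also note pairing_ge_integral_overlap
  finally show ?thesis .
qed

end

section \<open>The Riesz-Sobolev inequality\<close>

theorem theorem1p5:
  fixes \<mu> :: "'a::topological_ab_group_add measure"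
    and f g h :: "'a \<Rightarrow> real"
    and A B C :: "circle set"
  assumes "compact (UNIV :: 'a set)" and "connected (UNIV :: 'a set)"
    and "haar_measure \<mu>" and "emeasure \<mu> UNIV = 1"
    and "f \<in> borel_measurable \<mu>" and "\<And>x. f x \<in> {0..1}"
    and "g \<in> borel_measurable \<mu>" and "\<And>x. g x \<in> {0..1}"
    and "h \<in> borel_measurable \<mu>" and "\<And>x. h x \<in> {0..1}"
    and "centered_interval A" and "measure circle_measure A = (\<integral>x. f x \<partial>\<mu>)"
    and "centered_interval B" and "measure circle_measure B = (\<integral>x. g x \<partial>\<mu>)"
    and "centered_interval C" and "measure circle_measure C = (\<integral>x. h x \<partial>\<mu>)"
  shows "pairing \<mu> (conv \<mu> f g) h
       \<le> pairing circle_measure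
           (conv circle_measure (indicat_real A) (indicat_real B)) (indicat_real C)"
proof -
  define a where "a = (\<integral>x. f x \<partial>\<mu>)"
  define b where "b = (\<integral>x. g x \<partial>\<mu>)"
  define c where "c = (\<integral>x. h x \<partial>\<mu>)"
  interpret centered_intervals A B C a b c
    by unfold_locales (simp_all add: assms a_def b_def c_def)
  note le = haar_pairing_conv_le[OF assms(1-10) _ a_def b_def c_def]
  \<comment> \<open>The cases locate the vertex (a + b - c) / 2: at least min a b, at most 0, at
    most a + b - 1, or inside the admissible range.\<close>
  consider "c \<le> \<bar>a - b\<bar>" | "\<bar>a - b\<bar> < c" "a + b \<le> c" | "\<bar>a - b\<bar> < c" "c < a + b" "2 \<le> a + b + c"
    | "\<bar>a - b\<bar> < c" "c < a + b" "a + b + c < 2" by linarith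
  then show ?thesis
  proof cases
    case 1
    have "a * b - min a b * (a + b - min a b) + min a b * c = min a b * c"
      by (simp add: min_def algebra_simps)
    then show ?thesis using le[of "min a b"] pairing_ge_low[OF 1] measure_bounds by (simp add: min_def split: if_splits)
  next
    case 2
    show ?thesis using le[of 0] pairing_ge_high[of 0] measure_bounds 2 by simp
  next
    case 3
    show ?thesis using le[of "a + b - 1"] pairing_ge_high[of "a + b - 1"] measure_bounds 3 by simp
  next
    case 4
    define t where "t = (a + b - c) / 2"
    have "0 \<le> t" "t \<le> a" "t \<le> b" "a + b - t \<le> 1" "a + b - 2 * t = c"
      using 4 by (auto simp: t_def abs_less_iff field_simps)
    then show ?thesis using le[of t] pairing_ge_high[of t] by simp
  qed
qed

end
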